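(* Let $\mathscr F=\{f_\tau\colon M\rightarrow\mathbb{S}^{n+1}:\tau\in(0,\pi/g)\}$ be a family of positively oriented isoparametric hypersurfaces of $\mathbb{S}^{n+1}$ (with $g$ distinct principal curvatures), and let $W\in C^\infty(\Gamma)$ be a Weingarten function such that $W_{f_\tau}$ is well defined for all $f_\tau\in\mathscr F$. Given $\tau_0\in(0,\pi/g)$, assume that $W_{f_{\tau_0}}>0$ (resp. $W_{f_{\tau_0}}<0$), and that the function $\tau\mapsto W_{f_{\tau_0-\tau}}$ (resp. $\tau\mapsto W_{f_{\tau_0+\tau}}$) is increasing (resp. decreasing) on $[0,\tau_0)$ (resp. on $[0,\pi/g-\tau_0)$). Then the maximal parallel $\varphi$-flow solution $F_t=f_{\tau_0-\varphi(t)}$ to the $W$-flow $$\frac{\partial F}{\partial t}(p,t)=W(p,t)N(p,t)$$ with initial data $F_0=f_{\tau_0}$ collapses into the focal set $\mathscr F_+$ (resp. $\mathscr F_-$) at $t=\varphi^{-1}(\tau_0)$ (resp. $t=\varphi^{-1}(\tau_0-\pi/g)$).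
   Context: Weingarten functions. $\Gamma\subset\mathbb{R}^n$ is an open set containing $\Gamma_+=\{(k_1,\dots,k_n): k_i>0\}$. A function $W=W(k_1,\dots,k_n)\in C^\infty(\Gamma)$ is a Weingarten function if it is symmetric, homogeneous, monotonic increasing with respect to any of its variables, and positive on $\Gamma_+$. For an oriented hypersurface $f:M^n\to\overline M^{n+1}$ with principal curvature functions $k_1,\dots,k_n$, $W_f$ is well defined if $(k_1(p),\dots,k_n(p))\in\Gamma$ for all $p\in M$, and then $W_f(p):=W(k_1(p),\dots,k_n(p))$. For isoparametric hypersurfaces $W_f$ is a constant. Flows. A $W$-flow with initial data $f$ is a one-parameter family of smooth oriented immersions $F_t=F(\cdot,t):M^n\to\overline M^{n+1}$, $t\in[0,T)$, with $\partial F/\partial t(p,t)=W(p,t)N(p,t)$ and $F(p,0)=f(p)$, where $N(\cdot,t)$ is the unit normal of $F_t$ and $W(\cdot,t)=W_{F_t}$. A parallel $\varphi$-flow is a family $F_t(p)=\exp_{f(p)}(\varphi(t)N(p))$, $(p,t)\in M\times[0,T)$, with $\exp$ the exponential map of $\overline M^{n+1}$, $\varphi\in C^\infty[0,T)$, $\varphi(0)=0$, $N$ the unit normal to $f$, and unit normal of $F_t$ given by $N(p,t)=d\exp_{f(p)}(\varphi(t)N(p))N(p)$. The times $\varphi^{-1}(\tau_0)$ and $\varphi^{-1}(\tau_0-\pi/g)$ denote the end time at which $\varphi$ attains, in the limit, the indicated value. Isoparametric families in the sphere. An isoparametric hypersurface of $\mathbb{S}^{n+1}$ (all principal curvatures constant)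 with $g$ distinct principal curvatures, $g\in\{1,2,3,4,6\}$, is (Münzner) the intersection of $\mathbb{S}^{n+1}$ with a level set $P^{-1}(c)$, $c\in(-1,1)$, of a homogeneous polynomial $P:\mathbb{R}^{n+2}\to\mathbb{R}$ of degree $g$. Distinct level sets are parallel in $\mathbb{S}^{n+1}$, and the focal set of this parallel family has exactly two connected components, $\mathscr F_+:=P^{-1}(1)\cap\mathbb{S}^{n+1}$ and $\mathscr F_-:=P^{-1}(-1)\cap\mathbb{S}^{n+1}$. The family is parametrized as $\mathscr F=\{f_\tau:M\to\mathbb{S}^{n+1}:\tau\in(0,\pi/g)\}$, where $f_\tau(M)$ is at distance $\tau$ from $\mathscr F_+$. If $\gamma:(0,\pi/g)\to\mathbb{S}^{n+1}$ is the normalized geodesic from $\mathscr F_+$ to $\mathscr F_-$ orthogonal to $f_\tau$ at $p=\gamma(\tau)$, the positive orientation of $f_\tau$ is $N(p)=-\gamma'(\tau)$; with respect to it the $g$ distinct principal curvatures of $f_\tau$ are $k_i=\cot\left(\tau+(i-1)\frac{\pi}{g}\right)$, $1\le i\le g$. *)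

theory Defs
  imports "HOL-Analysis.Analysis"
begin

section \<open>Smooth functions\<close>

text \<open>The derivatives are full Frechet derivatives, so this is meant for open sets \<open>S\<close>.\<close>

fun Ck_on :: "nat \<Rightarrow> 'a::real_normed_vector set \<Rightarrow> ('a \<Rightarrow> 'b::real_normed_vector) \<Rightarrow> bool" where
  "Ck_on 0 S f \<longleftrightarrow> continuous_on S f"
| "Ck_on (Suc k) S f \<longleftrightarrow> (\<forall>x\<in>S. f differentiable (at x)) \<and>
     (\<forall>v. Ck_on k S (\<lambda>x. frechet_derivative f (at x) v))"

definition smooth_on :: "'a::real_normed_vector set \<Rightarrow> ('a \<Rightarrow> 'b::real_normed_vector) \<Rightarrow> bool" where
  "smooth_on S f \<longleftrightarrow> (\<forall>k. Ck_on k S f)"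

text \<open>The time interval \<open>[0,T)\<close>, with \<open>T = \<infinity>\<close> allowed. Smoothness on it is
  one-sided at \<open>0\<close>; the witness \<open>D k\<close> is the \<open>k\<close>-th derivative.\<close>

definition time_interval :: "ereal \<Rightarrow> real set" where
  "time_interval T = {t. 0 \<le> t \<and> ereal t < T}"

definition smooth_time :: "ereal \<Rightarrow> (real \<Rightarrow> real) \<Rightarrow> bool" where
  "smooth_time T \<phi> \<longleftrightarrow> (\<exists>D :: nat \<Rightarrow> real \<Rightarrow> real. D 0 = \<phi> \<and>
     (\<forall>k. \<forall>t\<in>time_interval T.
        (D k has_real_derivative D (Suc k) t) (at t within time_interval T)))"


section \<open>Smooth manifolds\<close>

text \<open>A chart is a pair \<open>(U, x)\<close> of a coordinate domain and a coordinate map. The manifold \<open>M\<close> is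
  the underlying set of the topology \<open>X\<close>, and its dimension is \<open>CARD('n)\<close>.\<close>

type_synonym ('a, 'n) chart = "'a set \<times> ('a \<Rightarrow> real ^ 'n)"

definition in_chart :: "('a, 'n::finite) chart \<Rightarrow> ('a \<Rightarrow> 'b) \<Rightarrow> real ^ 'n \<Rightarrow> 'b" where
  "in_chart c f = f \<circ> inv_into (fst c) (snd c)"

definition smooth_manifold :: "'a topology \<Rightarrow> ('a, 'n::finite) chart set \<Rightarrow> bool" where
  "smooth_manifold X \<A> \<longleftrightarrow>
     Hausdorff_space X \<and> second_countable X \<and>
     (\<Union>c\<in>\<A>. fst c) = topspace X \<and>
     (\<forall>(U, x)\<in>\<A>. openin X U \<and> open (x ` U) \<and>
        homeomorphic_map (subtopology X U) (top_of_set (x ` U)) x) \<and>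
     (\<forall>c\<in>\<A>. \<forall>(V, y)\<in>\<A>. smooth_on (snd c ` (fst c \<inter> V)) (in_chart c y))"

definition smooth_map :: "('a, 'n::finite) chart set \<Rightarrow> ('a \<Rightarrow> 'e::euclidean_space) \<Rightarrow> bool" where
  "smooth_map \<A> f \<longleftrightarrow> (\<forall>c\<in>\<A>. smooth_on (snd c ` fst c) (in_chart c f))"

text \<open>The differential of \<open>f\<close> at \<open>p\<close>, on tangent vectors given by their components in the chart \<open>c\<close>.\<close>

definition differential ::
  "('a, 'n::finite) chart \<Rightarrow> ('a \<Rightarrow> 'e::euclidean_space) \<Rightarrow> 'a \<Rightarrow> real ^ 'n \<Rightarrow> 'e" where
  "differential c f p = frechet_derivative (in_chart c f) (at (snd c p))"

definition immersive_at :: "('a, 'n::finite) chart set \<Rightarrow> ('a \<Rightarrow> 'e::euclidean_space) \<Rightarrow> 'a \<Rightarrow> bool" where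
  "immersive_at \<A> f p \<longleftrightarrow> (\<forall>c\<in>\<A>. p \<in> fst c \<longrightarrow> inj (differential c f p))"


section \<open>Oriented hypersurfaces of the unit sphere\<close>

abbreviation unit_sphere :: "'e::euclidean_space set" where
  "unit_sphere \<equiv> sphere 0 1"

text \<open>An oriented hypersurface is an immersion together with a unit normal field \<open>N\<close> tangent to the
  sphere. That \<open>M\<close> has codimension one is the condition \<open>DIM('e) = CARD('n) + 2\<close>.\<close>

definition oriented_hypersurface ::
  "('a, 'n::finite) chart set \<Rightarrow> 'a topology \<Rightarrow> ('a \<Rightarrow> 'e::euclidean_space) \<Rightarrow> ('a \<Rightarrow> 'e) \<Rightarrow> bool" where
  "oriented_hypersurface \<A> X f N \<longleftrightarrow>
     DIM('e) = CARD('n) + 2 \<and> smooth_map \<A> f \<and> smooth_map \<A> N \<and>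
     (\<forall>p\<in>topspace X. f p \<in> unit_sphere \<and> immersive_at \<A> f p \<and>
        norm (N p) = 1 \<and> N p \<bullet> f p = 0 \<and>
        (\<forall>c\<in>\<A>. p \<in> fst c \<longrightarrow> (\<forall>v. N p \<bullet> differential c f p v = 0)))"

text \<open>The components of \<open>k\<close> are the principal curvatures at \<open>p\<close>, repeated according to multiplicity
  and in some order. The shape operator \<open>S\<close> is given by \<open>df (S v) = - dN v\<close>, and \<open>b\<close> is a basis of
  the tangent space consisting of eigenvectors of \<open>S\<close>.\<close>

definition principal_curvatures ::
  "('a, 'n::finite) chart set \<Rightarrow> ('a \<Rightarrow> 'e::euclidean_space) \<Rightarrow> ('a \<Rightarrow> 'e) \<Rightarrow> 'a \<Rightarrow> real ^ 'n \<Rightarrow> bool" where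
  "principal_curvatures \<A> f N p k \<longleftrightarrow>
     (\<exists>c\<in>\<A>. p \<in> fst c \<and> (\<exists>b :: 'n \<Rightarrow> real ^ 'n. inj b \<and> independent (range b) \<and>
        (\<forall>i. differential c N p (b i) = - (k $ i) *\<^sub>R differential c f p (b i))))"

definition isoparametric ::
  "('a, 'n::finite) chart set \<Rightarrow> 'a topology \<Rightarrow> ('a \<Rightarrow> 'e::euclidean_space) \<Rightarrow> ('a \<Rightarrow> 'e) \<Rightarrow> bool" where
  "isoparametric \<A> X f N \<longleftrightarrow> oriented_hypersurface \<A> X f N \<and>
     (\<exists>k. \<forall>p\<in>topspace X. principal_curvatures \<A> f N p k)"

text \<open>The exponential map of the unit sphere at \<open>x\<close>; recall \<open>sgn v = v /\<^sub>R norm v\<close>. The formula is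
  used for all \<open>v\<close> in the ambient space, where it is a smooth function of \<open>v\<close>.\<close>

definition sphere_exp :: "'e::euclidean_space \<Rightarrow> 'e \<Rightarrow> 'e" where
  "sphere_exp x v = cos (norm v) *\<^sub>R x + sin (norm v) *\<^sub>R sgn v"

definition sphere_dist :: "'e::euclidean_space \<Rightarrow> 'e \<Rightarrow> real" where
  "sphere_dist x y = arccos (x \<bullet> y)"

definition unit_geodesic :: "(real \<Rightarrow> 'e::euclidean_space) \<Rightarrow> bool" where
  "unit_geodesic \<gamma> \<longleftrightarrow> (\<exists>x v. norm x = 1 \<and> norm v = 1 \<and> x \<bullet> v = 0 \<and>
     (\<forall>s. \<gamma> s = sphere_exp x (s *\<^sub>R v)))"

text \<open>Critical values of the normal exponential map \<open>(q, s) \<mapsto> exp (s N(q))\<close>: the points where a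
  parallel map fails to be an immersion.\<close>

definition focal_set ::
  "('a, 'n::finite) chart set \<Rightarrow> 'a topology \<Rightarrow> ('a \<Rightarrow> 'e::euclidean_space) \<Rightarrow> ('a \<Rightarrow> 'e) \<Rightarrow> 'e set" where
  "focal_set \<A> X f N = {sphere_exp (f p) (s *\<^sub>R N p) | p s. p \<in> topspace X \<and>
     \<not> immersive_at \<A> (\<lambda>q. sphere_exp (f q) (s *\<^sub>R N q)) p}"


section \<open>Isoparametric families\<close>

definition level :: "('e::euclidean_space \<Rightarrow> real) \<Rightarrow> real \<Rightarrow> 'e set" where
  "level P c = {x \<in> unit_sphere. P x = c}"

text \<open>A positively oriented isoparametric family, with Muenzner's structure theorem as part of the
  notion. The polynomial \<open>P\<close> is normalised to have values in \<open>[-1,1]\<close> on the sphere; the focal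
  sets are \<open>level P 1\<close> and \<open>level P (- 1)\<close>. The hypersurfaces are identified with one another
  along the common normal geodesics: \<open>\<tau> \<mapsto> f \<tau> p\<close> is the normal geodesic through \<open>p\<close>.\<close>

definition isoparametric_family ::
  "('a, 'n::finite) chart set \<Rightarrow> 'a topology \<Rightarrow> nat \<Rightarrow> ('e::euclidean_space \<Rightarrow> real) \<Rightarrow>
   (real \<Rightarrow> 'a \<Rightarrow> 'e) \<Rightarrow> (real \<Rightarrow> 'a \<Rightarrow> 'e) \<Rightarrow> bool" where
  "isoparametric_family \<A> X g P f N \<longleftrightarrow>
     g \<in> {1, 2, 3, 4, 6} \<and>
     real_polynomial_function P \<and> (\<forall>a x. P (a *\<^sub>R x) = a ^ g * P x) \<and>
     (\<forall>x\<in>unit_sphere. \<bar>P x\<bar> \<le> 1) \<and>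
     (\<forall>\<tau>\<in>{0<..<pi / g}. isoparametric \<A> X (f \<tau>) (N \<tau>) \<and> embedding_map X euclidean (f \<tau>) \<and>
        (\<exists>c\<in>{-1<..<1}. f \<tau> ` topspace X = level P c) \<and>
        components (focal_set \<A> X (f \<tau>) (N \<tau>)) = {level P 1, level P (-1)} \<and>
        (\<forall>p\<in>topspace X. (INF y\<in>level P 1. sphere_dist (f \<tau> p) y) = \<tau> \<and>
           (\<forall>k. principal_curvatures \<A> (f \<tau>) (N \<tau>) p k \<longrightarrow>
              range (($) k) = {cot (\<tau> + real (i - 1) * (pi / g)) | i. i \<in> {1..g}}))) \<and>
     (\<forall>c\<in>{-1<..<1}. \<exists>\<tau>\<in>{0<..<pi / g}. f \<tau> ` topspace X = level P c) \<and>
     (\<forall>p\<in>topspace X. \<exists>\<gamma>. unit_geodesic \<gamma> \<and> \<gamma> 0 \<in> level P 1 \<and> \<gamma> (pi / g) \<in> level P (-1) \<and>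
        (\<forall>\<tau>\<in>{0<..<pi / g}. f \<tau> p = \<gamma> \<tau> \<and> N \<tau> p = - vector_derivative \<gamma> (at \<tau>)))"


section \<open>Weingarten functions and flows\<close>

text \<open>Symmetry includes invariance of the domain \<open>\<Gamma>\<close> under permutations of the coordinates.
  Monotonicity in a variable is non-strict and along segments contained in \<open>\<Gamma>\<close>, as \<open>\<Gamma>\<close>
  need not be convex. The degree \<open>d\<close> of homogeneity is an arbitrary real number.\<close>

definition weingarten_function :: "(real ^ 'n::finite) set \<Rightarrow> (real ^ 'n \<Rightarrow> real) \<Rightarrow> bool" where
  "weingarten_function \<Gamma> W \<longleftrightarrow>
     open \<Gamma> \<and> {k. \<forall>i. k $ i > 0} \<subseteq> \<Gamma> \<and> smooth_on \<Gamma> W \<and>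
     (\<forall>\<pi> k. bij \<pi> \<and> k \<in> \<Gamma> \<longrightarrow> (\<chi> i. k $ \<pi> i) \<in> \<Gamma> \<and> W (\<chi> i. k $ \<pi> i) = W k) \<and>
     (\<exists>d :: real. \<forall>a>0. \<forall>k\<in>\<Gamma>. a *\<^sub>R k \<in> \<Gamma> \<longrightarrow> W (a *\<^sub>R k) = a powr d * W k) \<and>
     (\<forall>k i. \<forall>s\<ge>0. closed_segment k (k + axis i s) \<subseteq> \<Gamma> \<longrightarrow> W k \<le> W (k + axis i s)) \<and>
     (\<forall>k. (\<forall>i. k $ i > 0) \<longrightarrow> W k > 0)"

definition curvature_well_defined ::
  "('a, 'n::finite) chart set \<Rightarrow> 'a topology \<Rightarrow> (real ^ 'n) set \<Rightarrow>
   ('a \<Rightarrow> 'e::euclidean_space) \<Rightarrow> ('a \<Rightarrow> 'e) \<Rightarrow> bool" where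
  "curvature_well_defined \<A> X \<Gamma> f N \<longleftrightarrow>
     (\<forall>p\<in>topspace X. \<forall>k. principal_curvatures \<A> f N p k \<longrightarrow> k \<in> \<Gamma>)"

text \<open>The value \<open>W\<^sub>f(p)\<close>; by symmetry of \<open>W\<close> the chosen order of the principal curvatures
  does not matter.\<close>

definition weingarten_curvature ::
  "('a, 'n::finite) chart set \<Rightarrow> (real ^ 'n \<Rightarrow> real) \<Rightarrow>
   ('a \<Rightarrow> 'e::euclidean_space) \<Rightarrow> ('a \<Rightarrow> 'e) \<Rightarrow> 'a \<Rightarrow> real" where
  "weingarten_curvature \<A> W f N p = W (SOME k. principal_curvatures \<A> f N p k)"

definition W_flow ::
  "('a, 'n::finite) chart set \<Rightarrow> 'a topology \<Rightarrow> (real ^ 'n) set \<Rightarrow> (real ^ 'n \<Rightarrow> real) \<Rightarrow>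
   ('a \<Rightarrow> 'e::euclidean_space) \<Rightarrow> ereal \<Rightarrow> (real \<Rightarrow> 'a \<Rightarrow> 'e) \<Rightarrow> (real \<Rightarrow> 'a \<Rightarrow> 'e) \<Rightarrow> bool" where
  "W_flow \<A> X \<Gamma> W f T F N \<longleftrightarrow>
     0 < T \<and> (\<forall>p\<in>topspace X. F 0 p = f p) \<and>
     (\<forall>t\<in>time_interval T.
        oriented_hypersurface \<A> X (F t) (N t) \<and> curvature_well_defined \<A> X \<Gamma> (F t) (N t) \<and>
        (\<forall>p\<in>topspace X.
           ((\<lambda>s. F s p) has_vector_derivative weingarten_curvature \<A> W (F t) (N t) p *\<^sub>R N t p)
             (at t within time_interval T)))"

definition parallel_family ::
  "('a \<Rightarrow> 'e::euclidean_space) \<Rightarrow> ('a \<Rightarrow> 'e) \<Rightarrow> (real \<Rightarrow> real) \<Rightarrow> real \<Rightarrow> 'a \<Rightarrow> 'e" where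
  "parallel_family f N \<phi> t p = sphere_exp (f p) (\<phi> t *\<^sub>R N p)"

definition parallel_normal ::
  "('a \<Rightarrow> 'e::euclidean_space) \<Rightarrow> ('a \<Rightarrow> 'e) \<Rightarrow> (real \<Rightarrow> real) \<Rightarrow> real \<Rightarrow> 'a \<Rightarrow> 'e" where
  "parallel_normal f N \<phi> t p =
     frechet_derivative (sphere_exp (f p)) (at (\<phi> t *\<^sub>R N p)) (N p)"

definition parallel_solution ::
  "('a, 'n::finite) chart set \<Rightarrow> 'a topology \<Rightarrow> (real ^ 'n) set \<Rightarrow> (real ^ 'n \<Rightarrow> real) \<Rightarrow>
   ('a \<Rightarrow> 'e::euclidean_space) \<Rightarrow> ('a \<Rightarrow> 'e) \<Rightarrow> ereal \<Rightarrow> (real \<Rightarrow> real) \<Rightarrow> bool" where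
  "parallel_solution \<A> X \<Gamma> W f N T \<phi> \<longleftrightarrow>
     smooth_time T \<phi> \<and> \<phi> 0 = 0 \<and>
     W_flow \<A> X \<Gamma> W f T (parallel_family f N \<phi>) (parallel_normal f N \<phi>)"

definition maximal_parallel_solution ::
  "('a, 'n::finite) chart set \<Rightarrow> 'a topology \<Rightarrow> (real ^ 'n) set \<Rightarrow> (real ^ 'n \<Rightarrow> real) \<Rightarrow>
   ('a \<Rightarrow> 'e::euclidean_space) \<Rightarrow> ('a \<Rightarrow> 'e) \<Rightarrow> ereal \<Rightarrow> (real \<Rightarrow> real) \<Rightarrow> bool" where
  "maximal_parallel_solution \<A> X \<Gamma> W f N T \<phi> \<longleftrightarrow>
     parallel_solution \<A> X \<Gamma> W f N T \<phi> \<and>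
     \<not> (\<exists>T' \<psi>. T < T' \<and> parallel_solution \<A> X \<Gamma> W f N T' \<psi> \<and>
           (\<forall>t\<in>time_interval T. \<psi> t = \<phi> t))"

text \<open>Uniform convergence of the maps to a limit map of \<open>M\<close> onto \<open>A\<close>; in particular the images
  converge to \<open>A\<close> in the Hausdorff distance.\<close>

definition collapses_into ::
  "'a topology \<Rightarrow> (real \<Rightarrow> 'a \<Rightarrow> 'e::euclidean_space) \<Rightarrow> real \<Rightarrow> 'e set \<Rightarrow> bool" where
  "collapses_into X F T A \<longleftrightarrow>
     (\<exists>h. uniform_limit (topspace X) F h (at_left T) \<and> h ` topspace X = A)"

end

theory Submission
  imports Defs
begin

text \<open>
  Write \<open>\<delta> \<mapsto> F \<delta>\<close> for the parallel family of \<open>f \<tau>\<^sub>0\<close>, so that \<open>F \<delta> = f (\<tau>\<^sub>0 - \<delta>)\<close> for \<open>\<delta>\<close> in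
  \<open>I = (\<tau>\<^sub>0 - \<pi>/g, \<tau>\<^sub>0)\<close>. A parallel \<open>\<phi>\<close>-flow moves every point along its normal geodesic with speed
  \<open>\<phi>'(t)\<close>, so it solves the \<open>W\<close>-flow exactly when \<open>\<phi>' = w(\<phi>)\<close> and \<open>\<phi>(0) = 0\<close>, where \<open>w \<delta>\<close> is the value of
  the Weingarten curvature on \<open>F \<delta>\<close>. The geometric problem becomes a scalar autonomous equation on \<open>I\<close>.

  \<^item> The speed \<open>w\<close> is smooth. All members of the parallel family share one eigenbasis of their shape
    operators, and along it each principal curvature satisfies \<open>\<kappa>' = 1 + \<kappa>\<^sup>2\<close>; hence \<open>w = W \<circ> \<kappa>\<close> along a
    smooth curve \<open>\<kappa>\<close> in \<open>\<Gamma>\<close> (\<open>speed_function\<close>). This uses that the principal curvatures at a point are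
    determined up to order (\<open>principal_curvatures_permuted\<close>), so that the value of \<open>W\<close> does not depend
    on the vector of curvatures that is chosen.

  \<^item> Monotonicity bounds \<open>w\<close> away from zero on the part of \<open>I\<close> ahead of the initial value, so \<open>\<phi>\<close>,
    the inverse of the primitive of \<open>1/w\<close>, runs through that part in a finite time \<open>T\<close>; the same
    primitive shows that every solution agrees with \<open>\<phi>\<close> and stops by time \<open>T\<close>
    (\<open>autonomous_ode_reaches_right_endpoint\<close> and its mirror image).

  \<^item> No parallel solution can leave \<open>I\<close>, since \<open>F\<close> stops being an immersion at both end values
    (\<open>focal_at_endpoints\<close>). So \<open>\<phi>\<close> on \<open>[0,T)\<close> is the unique maximal parallel solution
    (\<open>parallel_flow_from_ode\<close>).

  \<^item> As \<open>\<phi>\<close> tends to an end value \<open>L\<close>, the maps converge uniformly to \<open>F L\<close>, which maps onto a whole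
    component of the focal set (\<open>focal_limit_maps_onto\<close>). For the surjectivity, the points \<open>F \<delta> p\<close> with \<open>\<delta>\<close> in the
    closure of \<open>I\<close> form a compact set containing all points of the sphere with \<open>\<bar>P\<bar> < 1\<close>. These are
    dense because \<open>P\<close> is a polynomial, so the set is the whole sphere, and a point with \<open>\<bar>P\<bar> = 1\<close> can
    only be reached at an end value.
\<close>


section \<open>Repeatedly differentiable functions of one variable\<close>

text \<open>Order 0 imposes no condition, not even continuity. This makes the class stable under composition
  with a curve by an induction whose base case is trivial, and nothing is lost when all orders
  are required at once.\<close>
fun times_differentiable :: "nat \<Rightarrow> real set \<Rightarrow> (real \<Rightarrow> real) \<Rightarrow> bool" where
  "times_differentiable 0 I h \<longleftrightarrow> True"
| "times_differentiable (Suc k) I h \<longleftrightarrow>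
     (\<exists>h'. (\<forall>x\<in>I. (h has_real_derivative h' x) (at x)) \<and> times_differentiable k I h')"

lemma times_differentiable_SucI:
  assumes "\<And>x. x \<in> I \<Longrightarrow> (h has_real_derivative h' x) (at x)" "times_differentiable k I h'"
  shows "times_differentiable (Suc k) I h"
  using assms by auto

lemma times_differentiable_lower: "times_differentiable (Suc k) I h \<Longrightarrow> times_differentiable k I h"
proof (induction k arbitrary: h)
  case (Suc k)
  then obtain h' where "\<forall>x\<in>I. (h has_real_derivative h' x) (at x)" "times_differentiable (Suc k) I h'"
    by auto
  then show ?case using Suc.IH by auto
qed simp

lemma times_differentiable_const [simp]: "times_differentiable k I (\<lambda>x. c)"
  by (induction k arbitrary: c) (auto intro!: exI[of _ "\<lambda>x. 0"] derivative_eq_intros)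

lemma times_differentiable_id [simp]: "times_differentiable k I (\<lambda>x. x)"
  by (cases k) (auto intro!: exI[of _ "\<lambda>x. 1"] derivative_eq_intros)

lemma times_differentiable_add:
  "times_differentiable k I h \<Longrightarrow> times_differentiable k I l \<Longrightarrow> times_differentiable k I (\<lambda>x. h x + l x)"
proof (induction k arbitrary: h l)
  case (Suc k)
  then obtain h' l' where "\<forall>x\<in>I. (h has_real_derivative h' x) (at x)" "times_differentiable k I h'"
    "\<forall>x\<in>I. (l has_real_derivative l' x) (at x)" "times_differentiable k I l'"
    by auto
  then show ?case
    by (intro times_differentiable_SucI[where h' = "\<lambda>x. h' x + l' x"] Suc.IH)
      (auto intro!: derivative_eq_intros)
qed simp

lemma times_differentiable_mult:
  "times_differentiable k I h \<Longrightarrow> times_differentiable k I l \<Longrightarrow> times_differentiable k I (\<lambda>x. h x * l x)"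
proof (induction k arbitrary: h l)
  case (Suc k)
  then obtain h' l' where *: "\<forall>x\<in>I. (h has_real_derivative h' x) (at x)" "times_differentiable k I h'"
    "\<forall>x\<in>I. (l has_real_derivative l' x) (at x)" "times_differentiable k I l'"
    by auto
  have "times_differentiable k I h" "times_differentiable k I l" using Suc.prems times_differentiable_lower by blast+
  with * show ?case
    by (intro times_differentiable_SucI[where h' = "\<lambda>x. h' x * l x + h x * l' x"] times_differentiable_add Suc.IH)
      (auto intro!: derivative_eq_intros)
qed simp

lemma times_differentiable_sum:
  assumes "\<And>i. i \<in> A \<Longrightarrow> times_differentiable k I (h i)"
  shows "times_differentiable k I (\<lambda>x. \<Sum>i\<in>A. h i x)"
  using assms
proof (induction A rule: infinite_finite_induct)
  case (insert a A)
  then have "times_differentiable k I (\<lambda>x. h a x + (\<Sum>i\<in>A. h i x))"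
    by (intro times_differentiable_add) simp_all
  with insert.hyps show ?case by simp
qed simp_all

lemma times_differentiable_compose:
  "times_differentiable k I h \<Longrightarrow> times_differentiable k J y \<Longrightarrow> y ` J \<subseteq> I \<Longrightarrow> times_differentiable k J (\<lambda>t. h (y t))"
proof (induction k arbitrary: h)
  case (Suc k)
  then obtain h' y' where *: "\<forall>x\<in>I. (h has_real_derivative h' x) (at x)" "times_differentiable k I h'"
    "\<forall>x\<in>J. (y has_real_derivative y' x) (at x)" "times_differentiable k J y'"
    by auto
  have "times_differentiable k J y" using Suc.prems times_differentiable_lower by blast
  then have 2: "times_differentiable k J (\<lambda>t. h' (y t) * y' t)"
    using Suc.IH[OF *(2) _ Suc.prems(3)] *(4) times_differentiable_mult by blast
  have 1: "\<forall>t\<in>J. ((\<lambda>t. h (y t)) has_real_derivative h' (y t) * y' t) (at t)"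
    using * Suc.prems(3) by (intro ballI DERIV_chain2) auto
  show ?case by (rule times_differentiable_SucI[OF bspec[OF 1] 2])
qed simp

text \<open>Bootstrapping: if \<open>y\<close> is \<open>k\<close> times differentiable, so is \<open>h \<circ> y\<close>, which is the derivative of \<open>y\<close>.\<close>
lemma times_differentiable_autonomous:
  assumes "\<And>t. t \<in> J \<Longrightarrow> (y has_real_derivative h (y t)) (at t)" "y ` J \<subseteq> I"
    and "\<And>k. times_differentiable k I h"
  shows "times_differentiable k J y"
proof (induction k)
  case (Suc k)
  have 2: "times_differentiable k J (\<lambda>t. h (y t))"
    by (rule times_differentiable_compose[OF assms(3) Suc assms(2)])
  have 1: "\<forall>t\<in>J. (y has_real_derivative h (y t)) (at t)"
    using assms(1) by blast
  show ?case by (rule times_differentiable_SucI[OF bspec[OF 1] 2])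
qed simp

lemma times_differentiable_cong:
  assumes "open I"
  shows "(\<And>x. x \<in> I \<Longrightarrow> h x = l x) \<Longrightarrow> times_differentiable k I h \<Longrightarrow> times_differentiable k I l"
proof (induction k arbitrary: h l)
  case (Suc k)
  then obtain h' where h': "\<forall>x\<in>I. (h has_real_derivative h' x) (at x)" "times_differentiable k I h'"
    by auto
  have "(l has_real_derivative h' x) (at x)" if "x \<in> I" for x
    using h'(1) that Suc.prems(1) assms has_field_derivative_transform_within_open by blast
  with h' show ?case by auto
qed simp

lemma times_differentiable_deriv:
  assumes "open I" "times_differentiable (Suc k) I h"
  shows "times_differentiable k I (deriv h)"
proof -
  obtain h' where h': "\<forall>x\<in>I. (h has_real_derivative h' x) (at x)" "times_differentiable k I h'"
    using assms by auto
  then have "\<And>x. x \<in> I \<Longrightarrow> h' x = deriv h x" by (metis DERIV_imp_deriv)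
  with h' assms(1) times_differentiable_cong show ?thesis by blast
qed

text \<open>The definition provides a separate tower of derivatives for every order. On an open set
  derivatives are unique, which merges the towers into the single sequence that
  \<open>smooth_time\<close> asks for.\<close>
lemma times_differentiable_derivatives:
  assumes "open I" "\<And>k. times_differentiable k I h"
  obtains D :: "nat \<Rightarrow> real \<Rightarrow> real" where "D 0 = h"
    "\<And>k x. x \<in> I \<Longrightarrow> (D k has_real_derivative D (Suc k) x) (at x)"
proof
  show "(deriv ^^ 0) h = h" by simp
  fix k x assume x: "x \<in> I"
  have "\<forall>j. times_differentiable j I ((deriv ^^ k) h)"
  proof (induction k)
    case 0
    show ?case using assms(2) by simp
  next
    case (Suc k)
    have "times_differentiable j I (deriv ((deriv ^^ k) h))" for j
      using Suc by (intro times_differentiable_deriv[OF assms(1)]) blast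
    then show ?case by simp
  qed
  then have "times_differentiable (Suc 0) I ((deriv ^^ k) h)" by blast
  with x obtain d where "((deriv ^^ k) h has_real_derivative d) (at x)" by auto
  then show "((deriv ^^ k) h has_real_derivative (deriv ^^ Suc k) h x) (at x)"
    using DERIV_imp_deriv by fastforce
qed

text \<open>The derivative of \<open>W \<circ> \<kappa>\<close> is \<open>\<Sum>i. \<kappa>\<^sub>i' \<cdot> (\<partial>\<^sub>i W \<circ> \<kappa>)\<close>, and each \<open>\<partial>\<^sub>i W\<close> is of one order of smoothness less
  than \<open>W\<close>, so induction over the order applies to every \<open>\<partial>\<^sub>i W\<close> in place of \<open>W\<close>.\<close>
lemma times_differentiable_curve:
  fixes W :: "real ^ 'n::finite \<Rightarrow> real" and \<kappa> :: "real \<Rightarrow> real ^ 'n"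
  assumes \<kappa>: "\<And>i k. times_differentiable k I (\<lambda>s. \<kappa> s $ i)" and in_\<Gamma>: "\<And>s. s \<in> I \<Longrightarrow> \<kappa> s \<in> \<Gamma>"
  shows "Ck_on k \<Gamma> W \<Longrightarrow> times_differentiable k I (\<lambda>s. W (\<kappa> s))"
proof (induction k arbitrary: W)
  case (Suc k)
  define partial_W where "partial_W i x = frechet_derivative W (at x) (axis i 1)" for i x
  have "\<forall>i. \<exists>d. (\<forall>s\<in>I. ((\<lambda>s. \<kappa> s $ i) has_real_derivative d s) (at s)) \<and> times_differentiable k I d"
    using \<kappa>[of "Suc k"] by simp
  then obtain d where d: "\<And>i s. s \<in> I \<Longrightarrow> ((\<lambda>s. \<kappa> s $ i) has_real_derivative d i s) (at s)"
    and d_diff: "\<And>i. times_differentiable k I (d i)"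
    by metis
  have deriv: "((\<lambda>s. W (\<kappa> s)) has_real_derivative (\<Sum>i\<in>UNIV. d i s * partial_W i (\<kappa> s))) (at s)"
    if s: "s \<in> I" for s
  proof -
    have "W differentiable (at (\<kappa> s))"
      using Suc.prems in_\<Gamma>[OF s] by auto
    then have W': "(W has_derivative frechet_derivative W (at (\<kappa> s))) (at (\<kappa> s))"
      using frechet_derivative_works by blast
    then interpret W': bounded_linear "frechet_derivative W (at (\<kappa> s))"
      using has_derivative_bounded_linear by blast
    have "(\<kappa> has_derivative (\<lambda>h. \<chi> i. h * d i s)) (at s)"
      by (rule has_derivative_componentwise_within[THEN iffD2])
        (use d[OF s] in \<open>auto simp: Basis_vec_def inner_axis has_field_derivative_def mult_commute_abs\<close>)
    from diff_chain_at[OF this W']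
    have "((\<lambda>s. W (\<kappa> s)) has_derivative (\<lambda>h. frechet_derivative W (at (\<kappa> s)) (\<chi> i. h * d i s))) (at s)"
      by (simp add: o_def)
    moreover have "frechet_derivative W (at (\<kappa> s)) (\<chi> i. h * d i s)
        = (\<Sum>i\<in>UNIV. d i s * partial_W i (\<kappa> s)) * h" for h
    proof -
      have "(\<chi> i. h * d i s) = (\<Sum>i\<in>UNIV. (h * d i s) *\<^sub>R axis i 1)"
        using basis_expansion[of "\<chi> i. h * d i s"] by (simp add: scalar_mult_eq_scaleR)
      then show ?thesis
        by (simp add: W'.sum W'.scaleR partial_W_def sum_distrib_left sum_distrib_right mult_ac)
    qed
    ultimately show ?thesis
      by (simp add: has_field_derivative_def)
  qed
  show ?case
  proof (rule times_differentiable_SucI[OF deriv])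
    show "times_differentiable k I (\<lambda>s. \<Sum>i\<in>UNIV. d i s * partial_W i (\<kappa> s))"
      by (intro times_differentiable_sum times_differentiable_mult d_diff Suc.IH) (use Suc.prems in \<open>simp add: partial_W_def\<close>)
  qed
qed simp


section \<open>An autonomous equation reaches the end of its interval in finite time\<close>

lemma time_interval_downward:
  "t \<in> time_interval T \<Longrightarrow> 0 \<le> s \<Longrightarrow> s \<le> t \<Longrightarrow> s \<in> time_interval T"
  unfolding time_interval_def by (auto intro: le_less_trans[of "ereal s" "ereal t"])

lemma convex_time_interval: "convex (time_interval T)"
proof -
  have "x \<in> time_interval T" if "a \<in> time_interval T" "b \<in> time_interval T" "a \<le> x" "x \<le> b" for a b x
    using time_interval_downward[OF that(2), of x] that by (simp add: time_interval_def)
  then show ?thesis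
    unfolding is_interval_convex_1[symmetric] is_interval_1 by blast
qed

lemma time_interval_real: "time_interval (ereal T) = {0..<T}"
  by (auto simp: time_interval_def)

text \<open>At every zero of \<open>\<psi>\<close> the derivative is \<open>h 0 > 0\<close>. After the last time at which \<open>\<psi>\<close> is nonnegative,
  a negative stretch would have to begin at a zero, where \<open>\<psi>\<close> increases.\<close>
lemma solution_nonneg:
  fixes \<psi> h :: "real \<Rightarrow> real"
  assumes h0: "h 0 > 0" and "\<psi> 0 = 0"
    and \<psi>': "\<And>t. t \<in> time_interval T \<Longrightarrow>
      (\<psi> has_real_derivative h (\<psi> t)) (at t within time_interval T)"
    and t: "t \<in> time_interval T"
  shows "0 \<le> \<psi> t"
proof (rule ccontr)
  assume neg: "\<not> 0 \<le> \<psi> t"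
  have t0: "0 \<le> t" using t by (simp add: time_interval_def)
  have sub: "{0..t} \<subseteq> time_interval T"
    using time_interval_downward[OF t] by auto
  have "continuous_on (time_interval T) \<psi>"
    using \<psi>' by (auto simp: continuous_on_eq_continuous_within intro: DERIV_continuous)
  then have cont: "continuous_on {0..t} \<psi>"
    using sub continuous_on_subset by blast
  define S where "S = {s \<in> {0..t}. 0 \<le> \<psi> s}"
  have "S = {0..t} \<inter> \<psi> -` {0..}" by (auto simp: S_def)
  moreover have "closed ({0..t} \<inter> \<psi> -` {0..})"
    using cont by (intro continuous_closed_preimage) auto
  ultimately have "closed S" by simp
  moreover have "0 \<in> S" using t0 \<open>\<psi> 0 = 0\<close> by (simp add: S_def)
  moreover have bdd: "bdd_above S" by (rule bdd_aboveI[of _ t]) (simp add: S_def)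
  ultimately have "Sup S \<in> S" by (intro closed_contains_Sup) auto
  define s where "s = Sup S"
  have s: "0 \<le> s" "s \<le> t" "0 \<le> \<psi> s" using \<open>Sup S \<in> S\<close> by (auto simp: S_def s_def)
  have after: "\<psi> r < 0" if "s < r" "r \<le> t" for r
  proof (rule ccontr)
    assume "\<not> \<psi> r < 0"
    then have "r \<in> S" using that s(1) by (simp add: S_def)
    then have "r \<le> s" unfolding s_def by (rule cSup_upper[OF _ bdd])
    with that show False by simp
  qed
  have "s < t" using s neg by (cases "s = t") auto
  have "\<exists>r\<ge>s. r \<le> t \<and> \<psi> r = 0"
    using s neg continuous_on_subset[OF cont] by (intro IVT2') auto
  then have "\<psi> s = 0"
    using after by (metis less_irrefl order_le_less)
  then have "(\<psi> has_real_derivative h 0) (at s within time_interval T)"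
    using \<psi>'[of s] sub s by auto
  from has_real_derivative_pos_inc_right[OF this h0]
  obtain d where d: "d > 0" "\<And>r. 0 < r \<Longrightarrow> s + r \<in> time_interval T \<Longrightarrow> r < d \<Longrightarrow> \<psi> s < \<psi> (s + r)"
    by blast
  define r where "r = min (d / 2) (t - s)"
  have "0 < r" "r < d" "s + r \<le> t" "s < s + r" using \<open>d > 0\<close> \<open>s < t\<close> by (auto simp: r_def)
  moreover have "s + r \<in> time_interval T" using sub s(1) \<open>0 < r\<close> \<open>s + r \<le> t\<close> by force
  ultimately show False
    using d(2)[of r] after[of "s + r"] \<open>\<psi> s = 0\<close> by simp
qed

definition solves_ivp :: "real \<Rightarrow> real \<Rightarrow> (real \<Rightarrow> real) \<Rightarrow> ereal \<Rightarrow> (real \<Rightarrow> real) \<Rightarrow> bool" where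
  "solves_ivp a b h T \<psi> \<longleftrightarrow> \<psi> 0 = 0 \<and> (\<forall>t\<in>time_interval T. \<psi> t \<in> {a<..<b} \<and>
     (\<psi> has_real_derivative h (\<psi> t)) (at t within time_interval T))"

text \<open>Separation of variables: a solution satisfies \<open>G (\<psi> t) = t\<close> for the primitive \<open>G\<close> of \<open>1/h\<close> that
  vanishes at 0. The lower bound \<open>h 0\<close> for \<open>h\<close> makes \<open>G\<close> bounded, and its supremum is the time \<open>T\<close>.
  The solution \<open>\<phi>\<close> is obtained on an open set \<open>J\<close> around \<open>[0,T)\<close>, so that its derivatives are
  two-sided also at 0.\<close>
lemma autonomous_ode_reaches_right_endpoint:
  fixes h :: "real \<Rightarrow> real"
  assumes "a < 0" "0 < b" and cont: "continuous_on {a<..<b} h"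
    and h0: "h 0 > 0" and lower: "\<And>s. s \<in> {0..<b} \<Longrightarrow> h 0 \<le> h s"
  obtains T J \<phi> where "0 < T" "open J" "{0..<T} \<subseteq> J"
    "\<forall>t\<in>J. \<phi> t \<in> {a<..<b} \<and> (\<phi> has_real_derivative h (\<phi> t)) (at t)"
    "\<phi> 0 = 0" "(\<phi> \<longlongrightarrow> b) (at_left T)"
    "\<forall>T' \<psi>. solves_ivp a b h T' \<psi> \<longrightarrow> (\<forall>t\<in>time_interval T'. t < T \<and> \<psi> t = \<phi> t)"
proof -
  have "isCont h 0"
    using cont assms(1,2) by (simp add: continuous_on_eq_continuous_at)
  then have "eventually (\<lambda>s. h s > 0) (at 0)"
    using h0 by (simp add: isCont_def order_tendstoD(1))
  then obtain d where d: "d > 0" "\<And>s. s \<noteq> 0 \<Longrightarrow> dist s 0 < d \<Longrightarrow> h s > 0"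
    by (auto simp: eventually_at)
  \<comment> \<open>By continuity \<open>h\<close> stays positive slightly to the left of 0; \<open>G\<close> is defined from such a point \<open>c\<close> on.\<close>
  define c where "c = max (a / 2) (- d / 2)"
  have c: "a < c" "c < 0" using assms(1) d(1) by (auto simp: c_def)
  have pos: "h s > 0" if "c \<le> s" "s < b" for s
  proof (cases "0 \<le> s")
    case True
    then show ?thesis using lower[of s] h0 that by auto
  next
    case False
    then show ?thesis using d that by (auto simp: c_def dist_real_def)
  qed
  have contc: "continuous_on {c..s} (\<lambda>r. 1 / h r)" if "s < b" for s
  proof (intro continuous_on_divide continuous_on_const ballI)
    show "continuous_on {c..s} h"
      by (rule continuous_on_subset[OF cont]) (use that c in auto)
    show "h r \<noteq> 0" if "r \<in> {c..s}" for r
      using pos[of r] that \<open>s < b\<close> by auto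
  qed
  define G where "G s = integral {c..s} (\<lambda>r. 1 / h r) - integral {c..0} (\<lambda>r. 1 / h r)" for s
  have G0: "G 0 = 0" unfolding G_def by (rule diff_self)
  have G': "(G has_real_derivative 1 / h s) (at s)" if "c < s" "s < b" for s
  proof -
    obtain e where e: "s < e" "e < b" using dense[OF \<open>s < b\<close>] by auto
    have "((\<lambda>s. integral {c..s} (\<lambda>r. 1 / h r)) has_real_derivative 1 / h s) (at s within {c..e})"
      using contc[of e] e that by (intro integral_has_real_derivative) auto
    moreover have "at s within {c..e} = at s"
      using that e by (intro at_within_interior) auto
    ultimately show ?thesis
      unfolding G_def by (auto intro!: derivative_eq_intros)
  qed
  have G_less: "G r < G s" if "c < r" "r < s" "s < b" for r s
  proof (rule DERIV_pos_imp_increasing[OF that(2)])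
    fix x assume "r \<le> x" "x \<le> s"
    then show "\<exists>y. DERIV G x :> y \<and> y > 0"
      using G'[of x] pos[of x] that by (intro exI[of _ "1 / h x"]) auto
  qed
  have G_bound: "G s \<le> s / h 0" if "0 \<le> s" "s < b" for s
  proof -
    have "G s - s / h 0 \<le> G 0 - 0 / h 0"
    proof (rule DERIV_nonpos_imp_nonincreasing[OF that(1)])
      fix x assume x: "0 \<le> x" "x \<le> s"
      have "((\<lambda>s. G s - s / h 0) has_real_derivative 1 / h x - 1 / h 0) (at x)"
        using G'[of x] x that c h0 by (auto intro!: derivative_eq_intros)
      moreover have "1 / h x \<le> 1 / h 0"
        using lower[of x] x that h0 by (intro divide_left_mono) auto
      ultimately show "\<exists>y. ((\<lambda>s. G s - s / h 0) has_real_derivative y) (at x) \<and> y \<le> 0"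
        by (intro exI conjI) auto
    qed
    then show ?thesis by (simp add: G0)
  qed
  define T where "T = (SUP s\<in>{0..<b}. G s)"
  have bdd: "bdd_above (G ` {0..<b})"
  proof (rule bdd_aboveI2)
    fix s assume "s \<in> {0..<b}"
    then show "G s \<le> b / h 0"
      using G_bound[of s] h0 divide_right_mono[of s b "h 0"] by auto
  qed
  have less_T: "G s < T" if "c < s" "s < b" for s
  proof -
    have "max s 0 < b" using that \<open>0 < b\<close> by simp
    then obtain e where e: "max s 0 < e" "e < b" using dense by blast
    then have "G s < G e" using G_less[of s e] that by auto
    also have "G e \<le> T" unfolding T_def using e by (intro cSUP_upper bdd) auto
    finally show ?thesis .
  qed
  have T_pos: "0 < T" using less_T[of 0] G0 c \<open>0 < b\<close> by simp
  define J where "J = {G (c / 2)<..<T}"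
  have onto: "\<exists>s. c < s \<and> s < b \<and> G s = t" if "t \<in> J" for t
  proof -
    have "t < T" using that by (simp add: J_def)
    then obtain e where e: "0 \<le> e" "e < b" "t < G e"
      unfolding T_def using \<open>0 < b\<close> by (subst (asm) less_cSUP_iff) (auto intro: bdd)
    have "\<exists>s\<ge>c / 2. s \<le> e \<and> G s = t"
    proof (rule IVT')
      show "continuous_on {c / 2..e} G"
        using G' e c by (intro DERIV_continuous_on[where D = "\<lambda>s. 1 / h s"])
          (auto intro: has_field_derivative_at_within)
    qed (use that e c in \<open>auto simp: J_def\<close>)
    then obtain s where "c / 2 \<le> s" "s \<le> e" "G s = t" by blast
    then show ?thesis using e c by (intro exI[of _ s]) auto
  qed
  define \<phi> where "\<phi> t = (SOME s. c < s \<and> s < b \<and> G s = t)" for t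
  have \<phi>: "c < \<phi> t" "\<phi> t < b" "G (\<phi> t) = t" if "t \<in> J" for t
    using someI_ex[OF onto[OF that]] by (auto simp: \<phi>_def)
  have G_inj: "r = s" if "c < r" "r < b" "c < s" "s < b" "G r = G s" for r s
    using G_less[of r s] G_less[of s r] that by (cases r s rule: linorder_cases) auto
  have \<phi>_G: "\<phi> (G s) = s" if "c < s" "s < b" for s
  proof -
    have "c < \<phi> (G s) \<and> \<phi> (G s) < b \<and> G (\<phi> (G s)) = G s"
      unfolding \<phi>_def by (rule someI[of _ s]) (use that in auto)
    then show ?thesis using G_inj that by blast
  qed
  have J: "open J" "{0..<T} \<subseteq> J"
    using G_less[of "c / 2" 0] G0 c \<open>0 < b\<close> by (auto simp: J_def)
  have \<phi>': "(\<phi> has_real_derivative h (\<phi> t)) (at t)" if t: "t \<in> J" for t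
  proof -
    define s where "s = \<phi> t"
    have s: "c < s" "s < b" "G s = t" using \<phi>[OF t] by (simp_all add: s_def)
    define e where "e = min (s - c) (b - s) / 2"
    have e: "e > 0" "e < s - c" "e < b - s" using s by (auto simp: e_def min_def)
    have near: "c < z \<and> z < b" if "\<bar>z - s\<bar> \<le> e" for z
      using that e by (auto simp: abs_le_iff)
    have "isCont \<phi> (G s)"
      using e near \<phi>_G G' by (intro isCont_inverse_function[of e s \<phi> G]) (auto intro: DERIV_isCont)
    then have "(\<phi> has_real_derivative inverse (1 / h s)) (at t)"
      using G'[OF s(1,2)] pos[of s] s t \<phi>(3)
      by (intro DERIV_inverse_function[where f = G and a = "G (c / 2)" and b = T])
        (auto simp: J_def s_def[symmetric])
    then show ?thesis by (simp add: s_def)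
  qed
  have \<phi>0: "\<phi> 0 = 0" using \<phi>_G[of 0] G0 c \<open>0 < b\<close> by simp
  have lim: "(\<phi> \<longlongrightarrow> b) (at_left T)"
  proof (rule order_tendstoI)
    fix y assume "y < b"
    define z where "z = max y 0"
    have z: "0 \<le> z" "z < b" "y \<le> z" using \<open>y < b\<close> \<open>0 < b\<close> by (auto simp: z_def)
    have "y < \<phi> t" if "t \<in> {max 0 (G z)<..<T}" for t
    proof (rule ccontr)
      assume "\<not> y < \<phi> t"
      moreover have "t \<in> J" using that J by auto
      ultimately have "G (\<phi> t) \<le> G z"
        using G_less[of "\<phi> t" z] \<phi>[of t] z by (cases "\<phi> t = z") auto
      then show False using \<phi>(3)[OF \<open>t \<in> J\<close>] that by auto
    qed
    then show "eventually (\<lambda>t. y < \<phi> t) (at_left T)"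
      using less_T[of z] z c T_pos by (intro eventually_at_leftI[of "max 0 (G z)"]) auto
  next
    fix y assume "b < y"
    then have "\<phi> t < y" if "t \<in> {0<..<T}" for t
      using \<phi>(2)[of t] J(2) that by (auto simp: subset_eq)
    then show "eventually (\<lambda>t. \<phi> t < y) (at_left T)"
      using T_pos by (intro eventually_at_leftI[of 0]) auto
  qed
  have unique: "t < T \<and> \<psi> t = \<phi> t"
    if sol: "solves_ivp a b h T' \<psi>" and t: "t \<in> time_interval T'" for T' \<psi> t
  proof -
    have \<psi>0: "\<psi> 0 = 0"
      and \<psi>: "\<And>s. s \<in> time_interval T' \<Longrightarrow> \<psi> s \<in> {a<..<b} \<and>
        (\<psi> has_real_derivative h (\<psi> s)) (at s within time_interval T')"
      using sol by (auto simp: solves_ivp_def)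
    have nonneg: "0 \<le> \<psi> s" if "s \<in> time_interval T'" for s
      using solution_nonneg[of h \<psi> T' s, OF h0 \<psi>0 _ that] \<psi> by blast
    \<comment> \<open>Separation of variables: \<open>(G \<circ> \<psi>)' = 1\<close>.\<close>
    have "((\<lambda>s. G (\<psi> s) - s) has_real_derivative 0) (at s within time_interval T')"
      if s: "s \<in> time_interval T'" for s
    proof -
      have "0 \<le> \<psi> s" "\<psi> s < b" using nonneg \<psi> s by auto
      then have "((\<lambda>s. G (\<psi> s)) has_real_derivative 1 / h (\<psi> s) * h (\<psi> s)) (at s within time_interval T')"
        using \<psi>[OF s] c by (intro DERIV_chain2[OF G']) auto
      moreover have "h (\<psi> s) \<noteq> 0" using pos[of "\<psi> s"] \<open>0 \<le> \<psi> s\<close> \<open>\<psi> s < b\<close> c by auto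
      ultimately show ?thesis by (auto intro!: derivative_eq_intros)
    qed
    from has_field_derivative_zero_constant[OF convex_time_interval this]
    obtain k where k: "\<And>s. s \<in> time_interval T' \<Longrightarrow> G (\<psi> s) - s = k" by blast
    have "0 \<in> time_interval T'"
      using time_interval_downward[OF t, of 0] t by (auto simp: time_interval_def)
    then have "k = 0" using k[of 0] \<psi>0 G0 by simp
    then have "G (\<psi> t) = t" using k[OF t] by simp
    moreover have "c < \<psi> t" "\<psi> t < b" using nonneg[OF t] \<psi>[OF t] c by auto
    ultimately show ?thesis using less_T[of "\<psi> t"] \<phi>_G[of "\<psi> t"] by simp
  qed
  have "\<forall>t\<in>J. \<phi> t \<in> {a<..<b} \<and> (\<phi> has_real_derivative h (\<phi> t)) (at t)"
    using \<phi>(1,2) \<phi>' c by fastforce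
  moreover have "\<forall>T' \<psi>. solves_ivp a b h T' \<psi> \<longrightarrow> (\<forall>t\<in>time_interval T'. t < T \<and> \<psi> t = \<phi> t)"
    using unique by blast
  ultimately show ?thesis
    using that[of T J \<phi>] T_pos J \<phi>0 lim by blast
qed

lemma solves_ivp_uminus:
  "solves_ivp a b h T \<psi> \<Longrightarrow> solves_ivp (- b) (- a) (\<lambda>s. - h (- s)) T (\<lambda>t. - \<psi> t)"
  unfolding solves_ivp_def by (auto intro!: derivative_eq_intros)

lemma autonomous_ode_reaches_left_endpoint:
  fixes h :: "real \<Rightarrow> real"
  assumes "a < 0" "0 < b" and cont: "continuous_on {a<..<b} h"
    and h0: "h 0 < 0" and upper: "\<And>s. s \<in> {a<..0} \<Longrightarrow> h s \<le> h 0"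
  obtains T J \<phi> where "0 < T" "open J" "{0..<T} \<subseteq> J"
    "\<forall>t\<in>J. \<phi> t \<in> {a<..<b} \<and> (\<phi> has_real_derivative h (\<phi> t)) (at t)"
    "\<phi> 0 = 0" "(\<phi> \<longlongrightarrow> a) (at_left T)"
    "\<forall>T' \<psi>. solves_ivp a b h T' \<psi> \<longrightarrow> (\<forall>t\<in>time_interval T'. t < T \<and> \<psi> t = \<phi> t)"
proof -
  have "continuous_on {- b<..<- a} (\<lambda>s. - h (- s))"
    by (intro continuous_intros continuous_on_compose2[OF cont]) auto
  from autonomous_ode_reaches_right_endpoint[OF _ _ this] assms(1,2) h0 upper
  obtain T J \<phi> where T: "0 < T" "open J" "{0..<T} \<subseteq> J"
    and \<phi>: "\<forall>t\<in>J. \<phi> t \<in> {- b<..<- a} \<and> (\<phi> has_real_derivative - h (- \<phi> t)) (at t)"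
    and \<phi>0: "\<phi> 0 = 0" and lim: "(\<phi> \<longlongrightarrow> - a) (at_left T)"
    and unique: "\<forall>T' \<psi>. solves_ivp (- b) (- a) (\<lambda>s. - h (- s)) T' \<psi> \<longrightarrow>
      (\<forall>t\<in>time_interval T'. t < T \<and> \<psi> t = \<phi> t)"
    by (auto simp: Ball_def)
  have "((\<lambda>t. - \<phi> t) has_real_derivative h (- \<phi> t)) (at t)" if "t \<in> J" for t
    using \<phi> that DERIV_minus[of \<phi> "- h (- \<phi> t)" t UNIV] by simp
  with \<phi> have "\<forall>t\<in>J. - \<phi> t \<in> {a<..<b} \<and> ((\<lambda>t. - \<phi> t) has_real_derivative h (- \<phi> t)) (at t)"
    by fastforce
  moreover have "((\<lambda>t. - \<phi> t) \<longlongrightarrow> a) (at_left T)"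
    using tendsto_minus[OF lim] by simp
  moreover have "\<forall>T' \<psi>. solves_ivp a b h T' \<psi> \<longrightarrow> (\<forall>t\<in>time_interval T'. t < T \<and> \<psi> t = - \<phi> t)"
  proof (intro allI impI ballI)
    fix T' \<psi> t assume "solves_ivp a b h T' \<psi>" "t \<in> time_interval T'"
    then have "t < T \<and> - \<psi> t = \<phi> t"
      using unique solves_ivp_uminus by blast
    then show "t < T \<and> \<psi> t = - \<phi> t" by auto
  qed
  ultimately show ?thesis
    using that[of T J "\<lambda>t. - \<phi> t"] T \<phi>0 by simp
qed


section \<open>Charts and differentials\<close>

text \<open>Maps on the manifold are compared on the underlying set only, so smoothness and differentials
  must not depend on values outside the chart domains.\<close>
lemma Ck_on_cong:
  assumes "open S"
  shows "(\<And>x. x \<in> S \<Longrightarrow> f x = f' x) \<Longrightarrow> Ck_on k S f \<Longrightarrow> Ck_on k S f'"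
proof (induction k arbitrary: f f')
  case 0
  then show ?case using continuous_on_cong by auto
next
  case (Suc k)
  have diff: "f differentiable (at x)" if "x \<in> S" for x
    using Suc.prems(2) that by simp
  have "f' differentiable (at x)" if "x \<in> S" for x
    using diff[OF that] Suc.prems(1) that \<open>open S\<close> has_derivative_transform_within_open
    unfolding differentiable_def by blast
  moreover have "Ck_on k S (\<lambda>x. frechet_derivative f' (at x) v)" for v
  proof (rule Suc.IH)
    show "Ck_on k S (\<lambda>x. frechet_derivative f (at x) v)" using Suc.prems(2) by simp
    show "frechet_derivative f (at x) v = frechet_derivative f' (at x) v" if "x \<in> S" for x
      using frechet_derivative_transform_within_open[OF diff[OF that] \<open>open S\<close> that Suc.prems(1)]
      by simp
  qed
  ultimately show ?case by simp
qed

lemma frechet_derivative_cong_open: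
  assumes "open S" "x \<in> S" "\<And>y. y \<in> S \<Longrightarrow> f y = f' y"
  shows "frechet_derivative f (at x) = frechet_derivative f' (at x)"
proof -
  have "(f has_derivative D) (at x) \<longleftrightarrow> (f' has_derivative D) (at x)" for D
    using assms has_derivative_transform_within_open[of f D x UNIV S f']
      has_derivative_transform_within_open[of f' D x UNIV S f] by auto
  then show ?thesis by (simp add: frechet_derivative_def)
qed

locale manifold =
  fixes X :: "'a topology" and \<A> :: "('a, 'n::finite) chart set"
  assumes manifold: "smooth_manifold X \<A>"
begin

lemma chart:
  assumes "c \<in> \<A>"
  shows chart_openin: "openin X (fst c)" and chart_image_open: "open (snd c ` fst c)"
    and chart_homeomorphic:
      "homeomorphic_map (subtopology X (fst c)) (top_of_set (snd c ` fst c)) (snd c)"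
  using assms manifold unfolding smooth_manifold_def by (auto simp: case_prod_unfold)

lemma chart_subset: "c \<in> \<A> \<Longrightarrow> fst c \<subseteq> topspace X"
  using chart_openin openin_subset by blast

lemma chart_inj:
  assumes "c \<in> \<A>"
  shows "inj_on (snd c) (fst c)"
  using homeomorphic_imp_injective_map[OF chart_homeomorphic[OF assms]] chart_subset[OF assms]
  by (simp add: Int_absorb1)

lemma in_chart_apply: "c \<in> \<A> \<Longrightarrow> p \<in> fst c \<Longrightarrow> in_chart c f (snd c p) = f p"
  using chart_inj by (simp add: in_chart_def)

lemma in_chart_cong:
  assumes "c \<in> \<A>" "\<And>p. p \<in> topspace X \<Longrightarrow> f p = f' p" "z \<in> snd c ` fst c"
  shows "in_chart c f z = in_chart c f' z"
proof -
  obtain p where "p \<in> fst c" "z = snd c p" using assms(3) by blast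
  then show ?thesis
    using assms(2) chart_subset[OF assms(1)] by (simp add: in_chart_apply[OF assms(1)] subset_eq)
qed

lemma point_in_chart: "p \<in> topspace X \<Longrightarrow> \<exists>c\<in>\<A>. p \<in> fst c"
  using manifold unfolding smooth_manifold_def by auto

lemma smooth_map_cong:
  assumes "smooth_map \<A> f" "\<And>p. p \<in> topspace X \<Longrightarrow> f p = f' p"
  shows "smooth_map \<A> f'"
  unfolding smooth_map_def smooth_on_def
proof (intro ballI allI)
  fix c k assume c: "c \<in> \<A>"
  have "in_chart c f z = in_chart c f' z" if "z \<in> snd c ` fst c" for z
    using c assms(2) that by (rule in_chart_cong)
  moreover have "Ck_on k (snd c ` fst c) (in_chart c f)"
    using assms(1) c unfolding smooth_map_def smooth_on_def by blast
  ultimately show "Ck_on k (snd c ` fst c) (in_chart c f')"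
    by (rule Ck_on_cong[OF chart_image_open[OF c]])
qed

lemma differential_cong:
  assumes "c \<in> \<A>" "p \<in> fst c" "\<And>p. p \<in> topspace X \<Longrightarrow> f p = f' p"
  shows "differential c f p = differential c f' p"
  unfolding differential_def
  by (rule frechet_derivative_cong_open[OF chart_image_open[OF assms(1)]])
    (use assms in_chart_cong[OF assms(1,3)] in auto)

lemma principal_curvatures_cong:
  assumes "\<And>p. p \<in> topspace X \<Longrightarrow> f p = f' p" "\<And>p. p \<in> topspace X \<Longrightarrow> N p = N' p"
  shows "principal_curvatures \<A> f N p k \<longleftrightarrow> principal_curvatures \<A> f' N' p k"
  unfolding principal_curvatures_def
  using differential_cong[of _ p f f'] differential_cong[of _ p N N'] assms
  by (intro bex_cong conj_cong refl) simp

lemma immersive_at_cong: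
  assumes "\<And>p. p \<in> topspace X \<Longrightarrow> f p = f' p"
  shows "immersive_at \<A> f p \<longleftrightarrow> immersive_at \<A> f' p"
  using differential_cong[of _ p f f'] assms unfolding immersive_at_def by simp

lemma weingarten_curvature_cong:
  assumes "\<And>p. p \<in> topspace X \<Longrightarrow> f p = f' p" "\<And>p. p \<in> topspace X \<Longrightarrow> N p = N' p"
  shows "weingarten_curvature \<A> W f N p = weingarten_curvature \<A> W f' N' p"
proof -
  have "principal_curvatures \<A> f N p = principal_curvatures \<A> f' N' p"
    by (intro ext principal_curvatures_cong assms)
  then show ?thesis by (simp add: weingarten_curvature_def)
qed

lemma curvature_well_defined_cong:
  assumes "curvature_well_defined \<A> X \<Gamma> f N"
    and "\<And>p. p \<in> topspace X \<Longrightarrow> f p = f' p" "\<And>p. p \<in> topspace X \<Longrightarrow> N p = N' p"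
  shows "curvature_well_defined \<A> X \<Gamma> f' N'"
  using assms(1) principal_curvatures_cong[of f f' N N'] assms(2,3)
  unfolding curvature_well_defined_def by simp

lemma oriented_hypersurface_cong:
  assumes "oriented_hypersurface \<A> X f N"
    and "\<And>p. p \<in> topspace X \<Longrightarrow> f p = f' p" "\<And>p. p \<in> topspace X \<Longrightarrow> N p = N' p"
  shows "oriented_hypersurface \<A> X f' N'"
proof -
  have "smooth_map \<A> f'" "smooth_map \<A> N'"
    using assms smooth_map_cong[of f f'] smooth_map_cong[of N N']
    unfolding oriented_hypersurface_def by blast+
  moreover have "f' p \<in> unit_sphere \<and> immersive_at \<A> f' p \<and> norm (N' p) = 1 \<and> N' p \<bullet> f' p = 0 \<and>
      (\<forall>c\<in>\<A>. p \<in> fst c \<longrightarrow> (\<forall>v. N' p \<bullet> differential c f' p v = 0))" if p: "p \<in> topspace X" for p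
  proof -
    have "f p \<in> unit_sphere \<and> immersive_at \<A> f p \<and> norm (N p) = 1 \<and> N p \<bullet> f p = 0"
      and "\<And>c v. c \<in> \<A> \<Longrightarrow> p \<in> fst c \<Longrightarrow> N p \<bullet> differential c f p v = 0"
      using assms(1) p unfolding oriented_hypersurface_def by blast+
    moreover have "immersive_at \<A> f p \<longleftrightarrow> immersive_at \<A> f' p"
      using assms(2) by (rule immersive_at_cong)
    moreover have "differential c f p = differential c f' p" if "c \<in> \<A>" "p \<in> fst c" for c
      using that assms(2) by (rule differential_cong)
    ultimately show ?thesis
      using assms(2,3)[OF p] by simp
  qed
  ultimately show ?thesis
    using assms(1) unfolding oriented_hypersurface_def by blast
qed

lemma smooth_map_has_derivative:
  assumes "smooth_map \<A> f" "c \<in> \<A>" "p \<in> fst c"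
  shows "(in_chart c f has_derivative differential c f p) (at (snd c p))"
proof -
  have "Ck_on (Suc 0) (snd c ` fst c) (in_chart c f)"
    using assms unfolding smooth_map_def smooth_on_def by blast
  then show ?thesis
    using assms(3) frechet_derivative_works unfolding differential_def by auto
qed

text \<open>Continuity is local, and on a chart domain the map is its smooth coordinate expression composed
  with the coordinate map.\<close>
lemma smooth_map_continuous:
  assumes "smooth_map \<A> f"
  shows "continuous_map X euclidean f"
  unfolding continuous_map_eq_topcontinuous_at
proof
  fix p assume "p \<in> topspace X"
  then obtain c where c: "c \<in> \<A>" "p \<in> fst c" using point_in_chart by blast
  have "Ck_on 0 (snd c ` fst c) (in_chart c f)"
    using assms c unfolding smooth_map_def smooth_on_def by blast
  then have "continuous_map (top_of_set (snd c ` fst c)) euclidean (in_chart c f)"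
    by simp
  from continuous_map_compose[OF homeomorphic_imp_continuous_map[OF chart_homeomorphic[OF c(1)]] this]
  have "continuous_map (subtopology X (fst c)) euclidean (in_chart c f \<circ> snd c)" .
  moreover have "(in_chart c f \<circ> snd c) q = f q" if "q \<in> topspace (subtopology X (fst c))" for q
    using that in_chart_apply[OF c(1), of q f] by simp
  ultimately have "continuous_map (subtopology X (fst c)) euclidean f"
    by (rule continuous_map_eq)
  then have "openin (subtopology X (fst c)) {q \<in> topspace X \<inter> fst c. f q \<in> V}" if "open V" for V
    using that by (simp add: continuous_map_def)
  then have "openin X {q \<in> topspace X \<inter> fst c. f q \<in> V}" if "open V" for V
    using that chart_openin[OF c(1)] by (meson openin_trans_full)
  then show "topcontinuous_at X euclidean f p"
    unfolding topcontinuous_at_def using c(2) \<open>p \<in> topspace X\<close>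
    by (auto intro!: exI[of _ "{q \<in> topspace X \<inter> fst c. f q \<in> V}" for V])
qed

lemma differential_linear:
  assumes "smooth_map \<A> f" "c \<in> \<A>" "p \<in> fst c"
  shows "linear (differential c f p)"
  using smooth_map_has_derivative[OF assms] has_derivative_linear by blast

lemma differential_combination:
  assumes "smooth_map \<A> f" "smooth_map \<A> N" "c \<in> \<A>" "p \<in> fst c"
  shows "differential c (\<lambda>q. x *\<^sub>R f q + y *\<^sub>R N q) p v
    = x *\<^sub>R differential c f p v + y *\<^sub>R differential c N p v"
proof -
  have "in_chart c (\<lambda>q. x *\<^sub>R f q + y *\<^sub>R N q) = (\<lambda>z. x *\<^sub>R in_chart c f z + y *\<^sub>R in_chart c N z)"
    by (simp add: in_chart_def fun_eq_iff)
  moreover have "((\<lambda>z. x *\<^sub>R in_chart c f z + y *\<^sub>R in_chart c N z) has_derivative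
      (\<lambda>v. x *\<^sub>R differential c f p v + y *\<^sub>R differential c N p v)) (at (snd c p))"
    using smooth_map_has_derivative[OF assms(1,3,4)] smooth_map_has_derivative[OF assms(2,3,4)]
    by (intro has_derivative_add has_derivative_scaleR_right)
  ultimately have "(in_chart c (\<lambda>q. x *\<^sub>R f q + y *\<^sub>R N q) has_derivative
      (\<lambda>v. x *\<^sub>R differential c f p v + y *\<^sub>R differential c N p v)) (at (snd c p))"
    by (simp only:)
  from frechet_derivative_at[OF this] show ?thesis
    unfolding differential_def[of c "\<lambda>q. x *\<^sub>R f q + y *\<^sub>R N q"] by (rule fun_cong[OF sym])
qed

end


section \<open>Principal curvatures are unique up to order\<close>

text \<open>The multiplicity with which \<open>\<mu>\<close> occurs in an eigenbasis of the pair \<open>(A, B)\<close> is the dimension of a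
  space that does not refer to the basis.\<close>
lemma card_eigenvalue_eq_dim_eigenspace:
  fixes A B :: "'v::euclidean_space \<Rightarrow> 'e::euclidean_space" and b :: "'n::finite \<Rightarrow> 'v"
  assumes "linear A" "linear B" "inj A"
    and b: "inj b" "independent (range b)" "CARD('n) = DIM('v)"
    and eigen: "\<And>i. B (b i) = - k i *\<^sub>R A (b i)"
  shows "card {i. k i = \<mu>} = dim {v. B v = - \<mu> *\<^sub>R A v}"
proof -
  interpret A: linear A by fact
  interpret B: linear B by fact
  have "span (range b) = UNIV"
    using b by (metis card_image card_ge_dim_independent dim_UNIV order_refl
        subset_UNIV subset_antisym)
  have "card {i. k i = \<mu>} = card (b ` {i. k i = \<mu>})"
    by (rule card_image[symmetric]) (use b(1) in \<open>auto intro: inj_on_subset\<close>)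
  also have "\<dots> = dim {v. B v = - \<mu> *\<^sub>R A v}"
  proof (rule dim_unique[symmetric])
    show "b ` {i. k i = \<mu>} \<subseteq> {v. B v = - \<mu> *\<^sub>R A v}" using eigen by auto
    show "independent (b ` {i. k i = \<mu>})"
      using b(2) by (rule independent_mono) auto
    show "{v. B v = - \<mu> *\<^sub>R A v} \<subseteq> span (b ` {i. k i = \<mu>})"
    proof clarify
      fix v assume v: "B v = - \<mu> *\<^sub>R A v"
      have "v \<in> span (range b)" using \<open>span (range b) = UNIV\<close> by simp
      then obtain u where "v = (\<Sum>w\<in>range b. u w *\<^sub>R w)"
        by (subst (asm) span_finite) auto
      then have v_sum: "v = (\<Sum>i\<in>UNIV. u (b i) *\<^sub>R b i)"
        using b(1) by (simp add: sum.reindex)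
      have "0 = B v + \<mu> *\<^sub>R A v" using v by simp
      also have "\<dots> = (\<Sum>i\<in>UNIV. (u (b i) * (\<mu> - k i)) *\<^sub>R A (b i))"
        unfolding v_sum A.sum B.sum A.scale B.scale eigen scaleR_sum_right sum.distrib[symmetric]
        by (intro sum.cong) (auto simp: algebra_simps)
      also have "\<dots> = A (\<Sum>i\<in>UNIV. (u (b i) * (\<mu> - k i)) *\<^sub>R b i)"
        by (simp add: A.sum A.scale)
      finally have "(\<Sum>i\<in>UNIV. (u (b i) * (\<mu> - k i)) *\<^sub>R b i) = 0"
        using \<open>inj A\<close> A.zero by (metis injD)
      then have "(\<Sum>w\<in>range b. (u w * (\<mu> - k (inv b w))) *\<^sub>R w) = 0"
        using b(1) by (simp add: sum.reindex)
      then have "u w * (\<mu> - k (inv b w)) = 0" if "w \<in> range b" for w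
        using independentD[OF b(2), of "range b" "\<lambda>w. u w * (\<mu> - k (inv b w))" w] that by simp
      from this[of "b i" for i] have zero: "u (b i) = 0 \<or> k i = \<mu>" for i
        using b(1) by auto
      show "v \<in> span (b ` {i. k i = \<mu>})"
        unfolding v_sum
      proof (rule span_sum)
        fix i
        show "u (b i) *\<^sub>R b i \<in> span (b ` {i. k i = \<mu>})"
          using zero[of i]
        proof
          assume "k i = \<mu>"
          then show ?thesis by (intro span_scale span_base) blast
        qed (simp add: span_zero)
      qed
    qed
  qed simp
  finally show ?thesis .
qed

lemma equal_fibre_sizes_imp_permuted:
  fixes k k' :: "'n::finite \<Rightarrow> 'b"
  assumes "\<And>\<mu>. card {i. k i = \<mu>} = card {i. k' i = \<mu>}"
  obtains \<pi> where "bij \<pi>" "\<And>i. k' i = k (\<pi> i)"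
proof -
  have "image_mset k' (mset_set UNIV) = image_mset k (mset_set UNIV)"
  proof (rule multiset_eqI)
    fix x
    have "{i. x = k i} = {i. k i = x}" "{i. x = k' i} = {i. k' i = x}" by auto
    then show "count (image_mset k' (mset_set UNIV)) x = count (image_mset k (mset_set UNIV)) x"
      using assms[of x] by (simp add: count_image_mset')
  qed
  from image_mset_eq_implies_permutes[OF finite_class.finite_UNIV this]
  obtain \<pi> where "\<pi> permutes UNIV" "\<forall>i\<in>UNIV. k' i = k (\<pi> i)" .
  then show ?thesis by (intro that[of \<pi>]) (auto intro: permutes_bij)
qed

context manifold
begin

text \<open>The differential in another chart is precomposed with the derivative \<open>L\<close> of the transition map.
  This is what makes principal curvatures computed in different charts comparable.\<close>
lemma change_of_chart:
  assumes "c \<in> \<A>" "p \<in> fst c" "c' \<in> \<A>" "p \<in> fst c'"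
  obtains L where "linear L"
    "\<And>f :: 'a \<Rightarrow> 'e::euclidean_space. smooth_map \<A> f \<Longrightarrow>
       differential c' f p = differential c f p \<circ> L"
proof -
  define S where "S = snd c' ` (fst c' \<inter> fst c)"
  have "openin (subtopology X (fst c')) (fst c' \<inter> fst c)"
    using chart_openin[OF assms(1)] by (rule openin_subtopology_Int2)
  then have "openin (top_of_set (snd c' ` fst c')) S"
    using homeomorphic_imp_open_map[OF chart_homeomorphic[OF assms(3)]]
    unfolding S_def open_map_def by blast
  then have "open S"
    using chart_image_open[OF assms(3)] by (rule openin_open_trans)
  have S: "snd c' p \<in> S" using assms by (auto simp: S_def)
  have "Ck_on (Suc 0) S (in_chart c' (snd c))"
    using manifold assms unfolding smooth_manifold_def smooth_on_def S_def
    by (fastforce simp: case_prod_unfold)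
  then obtain L where L: "(in_chart c' (snd c) has_derivative L) (at (snd c' p))"
    using S by (auto simp: differentiable_def)
  have "differential c' f p = differential c f p \<circ> L" if "smooth_map \<A> f" for f :: "'a \<Rightarrow> 'e"
  proof -
    have "in_chart c' (snd c) (snd c' p) = snd c p"
      using assms in_chart_apply by blast
    with smooth_map_has_derivative[OF that assms(1,2)]
    have "(in_chart c f \<circ> in_chart c' (snd c) has_derivative differential c f p \<circ> L) (at (snd c' p))"
      by (intro diff_chain_at[OF L]) simp
    moreover have "(in_chart c f \<circ> in_chart c' (snd c)) z = in_chart c' f z" if z: "z \<in> S" for z
    proof -
      obtain q where "q \<in> fst c" "q \<in> fst c'" "z = snd c' q" using z by (auto simp: S_def)
      then show ?thesis by (simp add: in_chart_apply[OF assms(1)] in_chart_apply[OF assms(3)])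
    qed
    ultimately have "(in_chart c' f has_derivative differential c f p \<circ> L) (at (snd c' p))"
      by (rule has_derivative_transform_within_open[OF _ \<open>open S\<close> S])
    then show ?thesis
      unfolding differential_def[of c' f] by (rule frechet_derivative_at[symmetric])
  qed
  with L has_derivative_linear that show ?thesis by blast
qed

text \<open>Two eigenbases, transported into a common chart, give each curvature value the multiplicity
  that is the dimension of its eigenspace; hence the two vectors differ by a permutation.\<close>
lemma principal_curvatures_permuted:
  fixes f N :: "'a \<Rightarrow> 'e::euclidean_space"
  assumes smooth: "smooth_map \<A> f" "smooth_map \<A> N" and "immersive_at \<A> f p"
    and "principal_curvatures \<A> f N p k" "principal_curvatures \<A> f N p k'"
  obtains \<pi> where "bij \<pi>" "k' = (\<chi> i. k $ \<pi> i)"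
proof -
  obtain c b where c: "c \<in> \<A>" "p \<in> fst c" and b: "inj b" "independent (range b)"
    and eigen: "\<And>i. differential c N p (b i) = - (k $ i) *\<^sub>R differential c f p (b i)"
    using assms(4) unfolding principal_curvatures_def by blast
  obtain c' b' where c': "c' \<in> \<A>" "p \<in> fst c'" and b': "inj b'" "independent (range b')"
    and eigen': "\<And>i. differential c' N p (b' i) = - (k' $ i) *\<^sub>R differential c' f p (b' i)"
    using assms(5) unfolding principal_curvatures_def by blast
  obtain L where "linear L"
    and L: "\<And>f :: 'a \<Rightarrow> 'e. smooth_map \<A> f \<Longrightarrow> differential c' f p = differential c f p \<circ> L"
    using change_of_chart[OF c c'] by blast
  have inj: "inj (differential c f p)" "inj (differential c' f p)"
    using assms(3) c c' unfolding immersive_at_def by auto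
  then have "inj L"
    using L[OF smooth(1)] by (metis inj_on_imageI2)
  have lin: "linear (differential c f p)" "linear (differential c N p)"
    using differential_linear smooth c by blast+
  have "card {i. k $ i = \<mu>} = card {i. k' $ i = \<mu>}" for \<mu>
  proof -
    have "card {i. k $ i = \<mu>} = dim {v. differential c N p v = - \<mu> *\<^sub>R differential c f p v}"
      by (rule card_eigenvalue_eq_dim_eigenspace[OF lin inj(1) b _ eigen]) simp
    moreover have "card {i. k' $ i = \<mu>} = dim {v. differential c N p v = - \<mu> *\<^sub>R differential c f p v}"
    proof (rule card_eigenvalue_eq_dim_eigenspace[OF lin inj(1), of "L \<circ> b'"])
      show "inj (L \<circ> b')" using \<open>inj L\<close> b'(1) by (rule inj_compose)
      show "independent (range (L \<circ> b'))"
        using linear_independent_injective_image[OF \<open>linear L\<close> b'(2)] \<open>inj L\<close>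
        by (simp add: image_comp inj_on_subset)
      show "differential c N p ((L \<circ> b') i) = - (k' $ i) *\<^sub>R differential c f p ((L \<circ> b') i)" for i
        using eigen'[of i] L[OF smooth(1)] L[OF smooth(2)] by simp
    qed simp
    ultimately show ?thesis by simp
  qed
  then obtain \<pi> where "bij \<pi>" "\<And>i. k' $ i = k $ \<pi> i"
    using equal_fibre_sizes_imp_permuted[of "($) k" "($) k'"] by blast
  then show ?thesis by (intro that[of \<pi>]) (simp_all add: vec_eq_iff)
qed

end


section \<open>Parallel hypersurfaces in the sphere\<close>

lemma sphere_exp_scaleR:
  "norm v = 1 \<Longrightarrow> sphere_exp x (s *\<^sub>R v) = cos s *\<^sub>R x + sin s *\<^sub>R v"
  by (cases s "0::real" rule: linorder_cases) (simp_all add: sphere_exp_def sgn_div_norm)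

text \<open>At the origin neither \<open>norm\<close> nor \<open>sgn\<close> is differentiable, so this case rests on
  \<open>(cos r - 1)/r \<longlonglongrightarrow> 0\<close> and \<open>sin r / r \<longlonglongrightarrow> 1\<close>.\<close>
lemma has_derivative_sphere_exp_0:
  fixes x :: "'e::euclidean_space"
  shows "(sphere_exp x has_derivative (\<lambda>v. v)) (at 0)"
  unfolding has_derivative_at
proof (intro conjI)
  have 1: "((\<lambda>r. (cos r - 1) / r) \<longlongrightarrow> 0) (at (0::real))"
    using DERIV_cos[of 0] by (simp add: has_field_derivative_iff)
  have 2: "((\<lambda>r. sin r / r - 1) \<longlongrightarrow> 1 - 1) (at (0::real))"
    using DERIV_sin[of 0] by (intro tendsto_diff tendsto_const) (simp add: has_field_derivative_iff)
  have "((\<lambda>r. \<bar>(cos r - 1) / r\<bar> * norm x + \<bar>sin r / r - 1\<bar>) \<longlongrightarrow> \<bar>0\<bar> * norm x + \<bar>1 - 1\<bar>) (at (0::real))"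
    by (intro tendsto_add tendsto_mult tendsto_rabs 1 2 tendsto_const)
  moreover have "filterlim norm (at 0) (at (0::'e))"
    unfolding filterlim_at by (auto intro: tendsto_norm_zero simp: eventually_at_filter)
  ultimately have lim: "((\<lambda>h::'e. \<bar>(cos (norm h) - 1) / norm h\<bar> * norm x + \<bar>sin (norm h) / norm h - 1\<bar>) \<longlongrightarrow> 0) (at 0)"
    by (auto dest: filterlim_compose)
  have bound: "norm (sphere_exp x (0 + h) - sphere_exp x 0 - h) / norm h
      \<le> \<bar>(cos (norm h) - 1) / norm h\<bar> * norm x + \<bar>sin (norm h) / norm h - 1\<bar>" if "h \<noteq> 0" for h :: 'e
  proof -
    have "sphere_exp x (0 + h) - sphere_exp x 0 - h
        = (cos (norm h) - 1) *\<^sub>R x + (sin (norm h) / norm h - 1) *\<^sub>R h"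
      by (simp add: sphere_exp_def sgn_div_norm algebra_simps divide_inverse)
    then have "norm (sphere_exp x (0 + h) - sphere_exp x 0 - h)
        \<le> \<bar>cos (norm h) - 1\<bar> * norm x + \<bar>sin (norm h) / norm h - 1\<bar> * norm h"
      by (metis norm_scaleR norm_triangle_ineq)
    then have "norm (sphere_exp x (0 + h) - sphere_exp x 0 - h) / norm h
        \<le> (\<bar>cos (norm h) - 1\<bar> * norm x + \<bar>sin (norm h) / norm h - 1\<bar> * norm h) / norm h"
      by (rule divide_right_mono) simp
    also have "\<dots> = \<bar>(cos (norm h) - 1) / norm h\<bar> * norm x + \<bar>sin (norm h) / norm h - 1\<bar>"
      using that by (simp add: add_divide_distrib)
    finally show ?thesis .
  qed
  show "((\<lambda>h. norm (sphere_exp x (0 + h) - sphere_exp x 0 - h) / norm h) \<longlongrightarrow> 0) (at 0)"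
    by (rule tendsto_sandwich[OF _ _ tendsto_const lim])
      (use bound in \<open>auto simp: eventually_at_filter intro!: always_eventually\<close>)
qed (rule bounded_linear_ident)

text \<open>Differentiability in all directions is needed because the unit normal of a parallel
  family is defined by the full derivative of the exponential map.\<close>
lemma sphere_exp_differentiable: "sphere_exp x differentiable (at v)"
proof (cases "v = 0")
  case True
  then show ?thesis using has_derivative_sphere_exp_0 differentiable_def by blast
next
  case False
  have cos_norm: "(\<lambda>v. cos (norm v)) differentiable (at v)"
    and sin_norm: "(\<lambda>v. sin (norm v)) differentiable (at v)"
    using differentiable_chain_at[OF differentiable_norm_at[OF False]]
      differentiableI[OF has_field_derivative_imp_has_derivative[OF DERIV_cos]]
      differentiableI[OF has_field_derivative_imp_has_derivative[OF DERIV_sin]]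
    unfolding o_def by blast+
  have "(\<lambda>v. cos (norm v) *\<^sub>R x + sin (norm v) *\<^sub>R (inverse (norm v) *\<^sub>R v)) differentiable (at v)"
    using False cos_norm sin_norm
    by (intro differentiable_add differentiable_scaleR differentiable_inverse differentiable_norm_at) auto
  then show ?thesis
    by (simp add: sphere_exp_def[abs_def] sgn_div_norm)
qed

lemma frechet_derivative_sphere_exp:
  assumes "norm v = 1"
  shows "frechet_derivative (sphere_exp x) (at (s *\<^sub>R v)) v = (- sin s) *\<^sub>R x + cos s *\<^sub>R v"
proof -
  have "((\<lambda>r. r *\<^sub>R v) has_derivative (\<lambda>h. h *\<^sub>R v)) (at s)"
    by (auto intro!: derivative_eq_intros)
  from diff_chain_at[OF this frechet_derivative_works[THEN iffD1, OF sphere_exp_differentiable]]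
  have 1: "((\<lambda>r. sphere_exp x (r *\<^sub>R v)) has_derivative
      (\<lambda>h. frechet_derivative (sphere_exp x) (at (s *\<^sub>R v)) (h *\<^sub>R v))) (at s)"
    by (simp add: o_def)
  have "(cos has_derivative (*) (- sin s)) (at s)" "(sin has_derivative (*) (cos s)) (at s)"
    using DERIV_cos[of s] DERIV_sin[of s] by (simp_all only: has_field_derivative_def)
  then have 2: "((\<lambda>r. sphere_exp x (r *\<^sub>R v)) has_derivative
      (\<lambda>h. (- sin s * h) *\<^sub>R x + (cos s * h) *\<^sub>R v)) (at s)"
    unfolding sphere_exp_scaleR[OF assms]
    by (intro has_derivative_add has_derivative_scaleR_left)
  from fun_cong[OF has_derivative_unique[OF 1 2], of 1] show ?thesis
    by simp
qed

definition parallel_hypersurface :: "('a \<Rightarrow> 'e::euclidean_space) \<Rightarrow> ('a \<Rightarrow> 'e) \<Rightarrow> real \<Rightarrow> 'a \<Rightarrow> 'e" where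
  "parallel_hypersurface f N \<delta> p = cos \<delta> *\<^sub>R f p + sin \<delta> *\<^sub>R N p"

definition parallel_unit_normal :: "('a \<Rightarrow> 'e::euclidean_space) \<Rightarrow> ('a \<Rightarrow> 'e) \<Rightarrow> real \<Rightarrow> 'a \<Rightarrow> 'e" where
  "parallel_unit_normal f N \<delta> p = (- sin \<delta>) *\<^sub>R f p + cos \<delta> *\<^sub>R N p"

text \<open>For \<open>k = cot \<theta>\<close> this is \<open>cot (\<theta> - \<delta>)\<close>. The rational form makes sense for every real \<open>k\<close>, and its
  denominator vanishes exactly at the focal distances.\<close>
definition parallel_curvature :: "real \<Rightarrow> real \<Rightarrow> real" where
  "parallel_curvature k \<delta> = (sin \<delta> + k * cos \<delta>) / (cos \<delta> - k * sin \<delta>)"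

lemma parallel_family_eq:
  "norm (N p) = 1 \<Longrightarrow> parallel_family f N \<phi> t p = parallel_hypersurface f N (\<phi> t) p"
  by (simp add: parallel_family_def parallel_hypersurface_def sphere_exp_scaleR)

lemma parallel_normal_eq:
  "norm (N p) = 1 \<Longrightarrow> parallel_normal f N \<phi> t p = parallel_unit_normal f N (\<phi> t) p"
  by (simp add: parallel_normal_def parallel_unit_normal_def frechet_derivative_sphere_exp)

text \<open>A Riccati equation, the infinitesimal form of the shift in \<open>cot (\<theta> - \<delta>)\<close>.\<close>
lemma parallel_curvature_has_derivative:
  assumes "cos \<delta> - k * sin \<delta> \<noteq> 0"
  shows "(parallel_curvature k has_real_derivative 1 + (parallel_curvature k \<delta>)\<^sup>2) (at \<delta>)"
  unfolding parallel_curvature_def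
  using assms
  by (auto intro!: derivative_eq_intros simp: power2_eq_square divide_simps) (simp add: algebra_simps)

context manifold
begin

lemma differential_parallel:
  assumes "smooth_map \<A> f" "smooth_map \<A> N" "c \<in> \<A>" "p \<in> fst c"
    and "differential c N p v = - k *\<^sub>R differential c f p v"
  shows "differential c (parallel_hypersurface f N \<delta>) p v
      = (cos \<delta> - k * sin \<delta>) *\<^sub>R differential c f p v"
    and "differential c (parallel_unit_normal f N \<delta>) p v
      = - (sin \<delta> + k * cos \<delta>) *\<^sub>R differential c f p v"
  unfolding parallel_hypersurface_def[abs_def] parallel_unit_normal_def[abs_def]
    differential_combination[OF assms(1-4)] assms(5)
  by (simp_all add: algebra_simps)

text \<open>The eigenvectors of the shape operator are kept along the parallel family, so the order and the
  multiplicities of the curvatures are kept as well.\<close>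
lemma principal_curvatures_parallel:
  assumes "smooth_map \<A> f" "smooth_map \<A> N" "principal_curvatures \<A> f N p k"
    and "\<And>i. cos \<delta> - k $ i * sin \<delta> \<noteq> 0"
  shows "principal_curvatures \<A> (parallel_hypersurface f N \<delta>) (parallel_unit_normal f N \<delta>) p
    (\<chi> i. parallel_curvature (k $ i) \<delta>)"
proof -
  obtain c b where c: "c \<in> \<A>" "p \<in> fst c" and b: "inj b" "independent (range b)"
    and eigen: "\<And>i. differential c N p (b i) = - (k $ i) *\<^sub>R differential c f p (b i)"
    using assms(3) unfolding principal_curvatures_def by blast
  have "differential c (parallel_unit_normal f N \<delta>) p (b i)
      = - ((\<chi> i. parallel_curvature (k $ i) \<delta>) $ i) *\<^sub>R differential c (parallel_hypersurface f N \<delta>) p (b i)" for i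
    unfolding differential_parallel[OF assms(1,2) c eigen]
    using assms(4)[of i] by (simp add: parallel_curvature_def)
  with c b show ?thesis unfolding principal_curvatures_def by blast
qed

text \<open>At a focal distance of \<open>k $ i\<close> the \<open>i\<close>-th eigenvector is annihilated by the differential.\<close>
lemma immersive_at_parallel_imp_nonfocal:
  assumes "smooth_map \<A> f" "smooth_map \<A> N" "principal_curvatures \<A> f N p k"
    and "immersive_at \<A> (parallel_hypersurface f N \<delta>) p"
  shows "cos \<delta> - k $ i * sin \<delta> \<noteq> 0"
proof
  assume zero: "cos \<delta> - k $ i * sin \<delta> = 0"
  obtain c b where c: "c \<in> \<A>" "p \<in> fst c" and b: "inj b" "independent (range b)"
    and eigen: "\<And>i. differential c N p (b i) = - (k $ i) *\<^sub>R differential c f p (b i)"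
    using assms(3) unfolding principal_curvatures_def by blast
  have inj: "inj (differential c (parallel_hypersurface f N \<delta>) p)"
    using assms(4) c by (simp add: immersive_at_def)
  have "linear (differential c (parallel_hypersurface f N \<delta>) p)"
    unfolding parallel_hypersurface_def[abs_def] differential_combination[OF assms(1,2) c, abs_def]
    using differential_linear assms(1,2) c by (intro linear_compose_add linear_compose_scale_right) blast+
  then have "differential c (parallel_hypersurface f N \<delta>) p 0 = 0"
    by (rule linear_0)
  moreover have "differential c (parallel_hypersurface f N \<delta>) p (b i) = 0"
    unfolding differential_parallel(1)[OF assms(1,2) c eigen] zero by simp
  ultimately have "b i = 0" using inj by (metis injD)
  then show False using b(2) dependent_zero by (metis rangeI)
qed

end


section \<open>Points off the extreme levels of a homogeneous polynomial\<close>

text \<open>For \<open>x \<noteq> 0\<close> the value of \<open>P\<close> at \<open>x/\<bar>x\<bar>\<close> is \<open>\<plusminus>1\<close> iff \<open>P(x)\<^sup>2 = (x \<bullet> x)\<^sup>g\<close>. Along the segment from \<open>y\<close>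
  to a zero \<open>w\<close> of \<open>P\<close> this is a polynomial equation which fails at the far end, so it has finitely
  many solutions and fails at points arbitrarily close to \<open>y\<close>.\<close>
lemma nonextreme_points_dense:
  fixes P :: "'e::euclidean_space \<Rightarrow> real"
  assumes P: "real_polynomial_function P" and homogeneous: "\<And>a x. P (a *\<^sub>R x) = a ^ g * P x"
    and bounded: "\<And>x. x \<in> unit_sphere \<Longrightarrow> \<bar>P x\<bar> \<le> 1"
    and w: "w \<in> unit_sphere" "P w = 0" and y: "y \<in> unit_sphere"
  shows "y \<in> closure {z \<in> unit_sphere. \<bar>P z\<bar> < 1}"
proof -
  define r where "r s = y + s *\<^sub>R (w - y)" for s :: real
  define Q where "Q x = (P x)\<^sup>2 - (x \<bullet> x) ^ g" for x
  have "real_polynomial_function (\<lambda>x::'e. \<Sum>b\<in>Basis. (x \<bullet> b)\<^sup>2)"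
    by (intro real_polynomial_function_sum real_polynomial_function_power
        real_polynomial_function.intros(1) bounded_linear_inner_left finite_Basis)
  moreover have "(\<lambda>x::'e. \<Sum>b\<in>Basis. (x \<bullet> b)\<^sup>2) = (\<lambda>x. x \<bullet> x)"
    by (auto simp: euclidean_inner[of x x for x] power2_eq_square)
  ultimately have "real_polynomial_function (\<lambda>x::'e. x \<bullet> x)" by simp
  then have "real_polynomial_function Q"
    unfolding Q_def using P by (intro real_polynomial_function_diff real_polynomial_function_power)
  moreover have "polynomial_function r"
    unfolding r_def by (intro polynomial_function_add polynomial_function_mult) auto
  ultimately have "real_polynomial_function (Q \<circ> r)"
    by (intro real_polynomial_function_compose)
  then obtain a n where a: "Q \<circ> r = (\<lambda>s. \<Sum>i\<le>n. a i * s ^ i)"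
    unfolding real_polynomial_function_iff_sum by blast
  have "(Q \<circ> r) 1 \<noteq> 0"
    using w by (simp add: Q_def r_def dot_square_norm)
  then have "(\<Sum>i\<le>n. a i) \<noteq> 0"
    unfolding a by simp
  then have "\<exists>i\<le>n. a i \<noteq> 0"
    by (meson atMost_iff sum.neutral)
  then have "finite {s. (Q \<circ> r) s = 0}"
    unfolding a by (simp add: polyfun_rootbound_finite)
  then have "\<not> 0 islimpt {s. (Q \<circ> r) s = 0}"
    using islimpt_finite by blast
  then have Q_ev: "eventually (\<lambda>s. Q (r s) \<noteq> 0) (at 0)"
    by (simp add: islimpt_iff_eventually)
  have r_lim: "(r \<longlongrightarrow> y) (at 0)"
    unfolding r_def by (auto intro!: tendsto_eq_intros)
  have y0: "y \<noteq> 0" "norm y = 1" using y by auto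
  have r_ev: "eventually (\<lambda>s. r s \<noteq> 0) (at 0)"
    using tendsto_imp_eventually_ne[OF r_lim y0(1)] .
  define z where "z s = (1 / norm (r s)) *\<^sub>R r s" for s
  have "(z \<longlongrightarrow> (1 / norm y) *\<^sub>R y) (at 0)"
    unfolding z_def using y0 by (intro tendsto_intros r_lim) auto
  then have z_lim: "(z \<longlongrightarrow> y) (at 0)" using y0 by simp
  have "z s \<in> {z \<in> unit_sphere. \<bar>P z\<bar> < 1}" if "Q (r s) \<noteq> 0" "r s \<noteq> 0" for s
  proof -
    have z: "z s \<in> unit_sphere" using that(2) by (simp add: z_def)
    have "P (r s) = norm (r s) ^ g * P (z s)"
      using homogeneous[of "norm (r s)" "z s"] that(2) by (simp add: z_def)
    then have "Q (r s) = (norm (r s) ^ g)\<^sup>2 * ((P (z s))\<^sup>2 - 1)"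
      by (simp add: Q_def dot_square_norm power_mult_distrib algebra_simps flip: power_mult)
    then have "(P (z s))\<^sup>2 \<noteq> 1" using that(1) by auto
    then have "\<bar>P (z s)\<bar> \<noteq> 1" by (metis one_power2 power2_abs)
    then show ?thesis using bounded[OF z] z by simp
  qed
  then have "eventually (\<lambda>s. z s \<in> closure {z \<in> unit_sphere. \<bar>P z\<bar> < 1}) (at 0)"
    using eventually_conj[OF Q_ev r_ev] by (auto elim!: eventually_mono intro: closure_subset[THEN subsetD])
  then show ?thesis
    by (rule Lim_in_closed_set[OF closed_closure _ _ z_lim]) simp
qed


section \<open>The isoparametric family as a parallel family\<close>

locale isoparametric_weingarten_family = manifold X \<A>
  for X :: "'a topology" and \<A> :: "('a, 'n::finite) chart set" +
  fixes f N :: "real \<Rightarrow> 'a \<Rightarrow> 'e::euclidean_space"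
    and P :: "'e \<Rightarrow> real" and g :: nat
    and \<Gamma> :: "(real ^ 'n) set" and W :: "real ^ 'n \<Rightarrow> real"
    and \<tau>\<^sub>0 :: real
  assumes family: "isoparametric_family \<A> X g P f N"
    and weingarten: "weingarten_function \<Gamma> W"
    and well_defined: "\<tau> \<in> {0<..<pi / g} \<Longrightarrow> curvature_well_defined \<A> X \<Gamma> (f \<tau>) (N \<tau>)"
    and \<tau>\<^sub>0: "\<tau>\<^sub>0 \<in> {0<..<pi / g}"
begin

text \<open>The parallel family is parametrised by the signed distance \<open>\<delta> = \<tau>\<^sub>0 - \<tau>\<close> from the initial
  member, measured along the normal \<open>N \<tau>\<^sub>0\<close>, which points towards \<open>level P 1\<close>. In contrast to \<open>f\<close>, it
  is meaningful for all real \<open>\<delta>\<close>, in particular at the focal distances.\<close>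
abbreviation "F \<equiv> parallel_hypersurface (f \<tau>\<^sub>0) (N \<tau>\<^sub>0)"
abbreviation "U \<equiv> parallel_unit_normal (f \<tau>\<^sub>0) (N \<tau>\<^sub>0)"

lemma g_pos: "0 < g"
  using family unfolding isoparametric_family_def by auto

lemma pi_over_g_le: "pi / g \<le> pi"
  using g_pos by (simp add: field_simps)

lemma members:
  assumes "\<tau> \<in> {0<..<pi / g}"
  shows isoparametric: "isoparametric \<A> X (f \<tau>) (N \<tau>)"
    and embedding: "embedding_map X euclidean (f \<tau>)"
    and image_level: "\<exists>c\<in>{-1<..<1}. f \<tau> ` topspace X = level P c"
    and focal_components:
      "components (focal_set \<A> X (f \<tau>) (N \<tau>)) = {level P 1, level P (-1)}"
    and curvature_values: "p \<in> topspace X \<Longrightarrow> principal_curvatures \<A> (f \<tau>) (N \<tau>) p k \<Longrightarrow>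
      range (($) k) = {cot (\<tau> + real (i - 1) * (pi / g)) | i. i \<in> {1..g}}"
proof -
  have "\<forall>\<tau>\<in>{0<..<pi / g}. isoparametric \<A> X (f \<tau>) (N \<tau>) \<and> embedding_map X euclidean (f \<tau>) \<and>
      (\<exists>c\<in>{-1<..<1}. f \<tau> ` topspace X = level P c) \<and>
      components (focal_set \<A> X (f \<tau>) (N \<tau>)) = {level P 1, level P (-1)} \<and>
      (\<forall>p\<in>topspace X. (INF y\<in>level P 1. sphere_dist (f \<tau> p) y) = \<tau> \<and>
         (\<forall>k. principal_curvatures \<A> (f \<tau>) (N \<tau>) p k \<longrightarrow>
            range (($) k) = {cot (\<tau> + real (i - 1) * (pi / g)) | i. i \<in> {1..g}}))"
    using family unfolding isoparametric_family_def by (elim conjE)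
  note facts = bspec[OF this assms]
  show "isoparametric \<A> X (f \<tau>) (N \<tau>)" using facts by (elim conjE)
  show "embedding_map X euclidean (f \<tau>)" using facts by (elim conjE)
  show "\<exists>c\<in>{-1<..<1}. f \<tau> ` topspace X = level P c" using facts by (elim conjE)
  show "components (focal_set \<A> X (f \<tau>) (N \<tau>)) = {level P 1, level P (-1)}"
    using facts by (elim conjE)
  show "range (($) k) = {cot (\<tau> + real (i - 1) * (pi / g)) | i. i \<in> {1..g}}"
    if p: "p \<in> topspace X" and k: "principal_curvatures \<A> (f \<tau>) (N \<tau>) p k"
  proof -
    have "\<forall>p\<in>topspace X. (INF y\<in>level P 1. sphere_dist (f \<tau> p) y) = \<tau> \<and>
         (\<forall>k. principal_curvatures \<A> (f \<tau>) (N \<tau>) p k \<longrightarrow>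
            range (($) k) = {cot (\<tau> + real (i - 1) * (pi / g)) | i. i \<in> {1..g}})"
      using facts by (elim conjE)
    from conjunct2[OF bspec[OF this p]] k show ?thesis by (elim allE[of _ k] mp)
  qed
qed

lemma polynomial: "real_polynomial_function P" "P (a *\<^sub>R x) = a ^ g * P x"
    "x \<in> unit_sphere \<Longrightarrow> \<bar>P x\<bar> \<le> 1"
  and level_attained: "c \<in> {-1<..<1} \<Longrightarrow> \<exists>\<tau>\<in>{0<..<pi / g}. f \<tau> ` topspace X = level P c"
proof -
  have "real_polynomial_function P \<and> (\<forall>a x. P (a *\<^sub>R x) = a ^ g * P x) \<and>
     (\<forall>x\<in>unit_sphere. \<bar>P x\<bar> \<le> 1) \<and>
     (\<forall>c\<in>{-1<..<1}. \<exists>\<tau>\<in>{0<..<pi / g}. f \<tau> ` topspace X = level P c)"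
    using family unfolding isoparametric_family_def by (elim conjE) (intro conjI)
  then show "real_polynomial_function P" "P (a *\<^sub>R x) = a ^ g * P x"
    "x \<in> unit_sphere \<Longrightarrow> \<bar>P x\<bar> \<le> 1"
    "c \<in> {-1<..<1} \<Longrightarrow> \<exists>\<tau>\<in>{0<..<pi / g}. f \<tau> ` topspace X = level P c"
    by blast+
qed

lemma common_curvatures:
  assumes "\<tau> \<in> {0<..<pi / g}"
  obtains k where "\<And>p. p \<in> topspace X \<Longrightarrow> principal_curvatures \<A> (f \<tau>) (N \<tau>) p k"
  using isoparametric[OF assms] unfolding isoparametric_def by blast

lemma oriented: "\<tau> \<in> {0<..<pi / g} \<Longrightarrow> oriented_hypersurface \<A> X (f \<tau>) (N \<tau>)"
  using isoparametric unfolding isoparametric_def by blast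

lemma smooth: "smooth_map \<A> (f \<tau>\<^sub>0)" "smooth_map \<A> (N \<tau>\<^sub>0)"
  using oriented[OF \<tau>\<^sub>0] unfolding oriented_hypersurface_def by blast+

lemma norm_eq_1:
  assumes "p \<in> topspace X"
  shows "norm (f \<tau>\<^sub>0 p) = 1" "norm (N \<tau>\<^sub>0 p) = 1"
  using oriented[OF \<tau>\<^sub>0] assms unfolding oriented_hypersurface_def by auto

text \<open>If \<open>\<gamma>\<close> is the normal geodesic through \<open>p\<close>, then \<open>F \<delta> p = \<gamma> (\<tau>\<^sub>0 - \<delta>)\<close> by the addition theorems;
  the sign comes from the orientation \<open>N \<tau> p = - \<gamma>' \<tau>\<close>.\<close>
lemma on_normal_geodesic:
  assumes p: "p \<in> topspace X"
  shows "\<tau> \<in> {0<..<pi / g} \<Longrightarrow> f \<tau> p = F (\<tau>\<^sub>0 - \<tau>) p"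
    and "\<tau> \<in> {0<..<pi / g} \<Longrightarrow> N \<tau> p = U (\<tau>\<^sub>0 - \<tau>) p"
    and "F \<tau>\<^sub>0 p \<in> level P 1"
    and "F (\<tau>\<^sub>0 - pi / g) p \<in> level P (-1)"
proof -
  have "\<forall>p\<in>topspace X. \<exists>\<gamma>. unit_geodesic \<gamma> \<and> \<gamma> 0 \<in> level P 1 \<and> \<gamma> (pi / g) \<in> level P (-1) \<and>
      (\<forall>\<tau>\<in>{0<..<pi / g}. f \<tau> p = \<gamma> \<tau> \<and> N \<tau> p = - vector_derivative \<gamma> (at \<tau>))"
    using family unfolding isoparametric_family_def by (elim conjE)
  from bspec[OF this p] obtain \<gamma> where geodesic: "unit_geodesic \<gamma>"
    and ends: "\<gamma> 0 \<in> level P 1" "\<gamma> (pi / g) \<in> level P (-1)"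
    and \<gamma>: "\<forall>\<tau>\<in>{0<..<pi / g}. f \<tau> p = \<gamma> \<tau> \<and> N \<tau> p = - vector_derivative \<gamma> (at \<tau>)"
    by (elim exE conjE)
  obtain x v where "norm v = 1" and "\<forall>s. \<gamma> s = sphere_exp x (s *\<^sub>R v)"
    using geodesic unfolding unit_geodesic_def by (elim exE conjE)
  then have \<gamma>_eq: "\<gamma> = (\<lambda>s. cos s *\<^sub>R x + sin s *\<^sub>R v)"
    by (simp add: sphere_exp_scaleR fun_eq_iff)
  have "vector_derivative \<gamma> (at s) = (- sin s) *\<^sub>R x + cos s *\<^sub>R v" for s
  proof (rule vector_derivative_at)
    have "(\<gamma> has_derivative (\<lambda>h. (- sin s * h) *\<^sub>R x + (cos s * h) *\<^sub>R v)) (at s)"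
      unfolding \<gamma>_eq using DERIV_cos[of s] DERIV_sin[of s]
      by (intro has_derivative_add has_derivative_scaleR_left) (simp_all only: has_field_derivative_def)
    then show "(\<gamma> has_vector_derivative (- sin s) *\<^sub>R x + cos s *\<^sub>R v) (at s)"
      by (simp add: has_vector_derivative_def algebra_simps)
  qed
  then have f: "\<And>\<tau>. \<tau> \<in> {0<..<pi / g} \<Longrightarrow> f \<tau> p = cos \<tau> *\<^sub>R x + sin \<tau> *\<^sub>R v"
    and N: "\<And>\<tau>. \<tau> \<in> {0<..<pi / g} \<Longrightarrow> N \<tau> p = sin \<tau> *\<^sub>R x - cos \<tau> *\<^sub>R v"
    using \<gamma> by (simp_all add: \<gamma>_eq)
  have F: "F \<delta> p = cos (\<tau>\<^sub>0 - \<delta>) *\<^sub>R x + sin (\<tau>\<^sub>0 - \<delta>) *\<^sub>R v" for \<delta>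
    unfolding parallel_hypersurface_def f[OF \<tau>\<^sub>0] N[OF \<tau>\<^sub>0] cos_diff sin_diff
    by (simp add: algebra_simps)
  have U: "U \<delta> p = sin (\<tau>\<^sub>0 - \<delta>) *\<^sub>R x - cos (\<tau>\<^sub>0 - \<delta>) *\<^sub>R v" for \<delta>
    unfolding parallel_unit_normal_def f[OF \<tau>\<^sub>0] N[OF \<tau>\<^sub>0] cos_diff sin_diff
    by (simp add: algebra_simps)
  show "\<tau> \<in> {0<..<pi / g} \<Longrightarrow> f \<tau> p = F (\<tau>\<^sub>0 - \<tau>) p"
    by (simp add: F f)
  show "\<tau> \<in> {0<..<pi / g} \<Longrightarrow> N \<tau> p = U (\<tau>\<^sub>0 - \<tau>) p"
    by (simp add: U N)
  show "F \<tau>\<^sub>0 p \<in> level P 1" "F (\<tau>\<^sub>0 - pi / g) p \<in> level P (-1)"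
    using ends by (simp_all add: F \<gamma>_eq)
qed

lemma F_eq: "p \<in> topspace X \<Longrightarrow> \<delta> \<in> {\<tau>\<^sub>0 - pi / g<..<\<tau>\<^sub>0} \<Longrightarrow> F \<delta> p = f (\<tau>\<^sub>0 - \<delta>) p"
  and U_eq: "p \<in> topspace X \<Longrightarrow> \<delta> \<in> {\<tau>\<^sub>0 - pi / g<..<\<tau>\<^sub>0} \<Longrightarrow> U \<delta> p = N (\<tau>\<^sub>0 - \<delta>) p"
  using on_normal_geodesic(1,2)[of p "\<tau>\<^sub>0 - \<delta>"] by simp_all

text \<open>Connected components are nonempty, so the focal set is nonempty, and it consists of points on
  normal geodesics of \<open>M\<close>.\<close>
lemma topspace_nonempty: "topspace X \<noteq> {}"
proof -
  have "level P 1 \<in> components (focal_set \<A> X (f \<tau>\<^sub>0) (N \<tau>\<^sub>0))"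
    by (simp add: focal_components[OF \<tau>\<^sub>0])
  then have "focal_set \<A> X (f \<tau>\<^sub>0) (N \<tau>\<^sub>0) \<noteq> {}"
    using in_components_nonempty in_components_subset by blast
  then show ?thesis unfolding focal_set_def by blast
qed

lemma parallel_oriented:
  assumes "\<delta> \<in> {\<tau>\<^sub>0 - pi / g<..<\<tau>\<^sub>0}"
  shows "oriented_hypersurface \<A> X (F \<delta>) (U \<delta>)"
proof -
  have \<tau>: "\<tau>\<^sub>0 - \<delta> \<in> {0<..<pi / g}" using assms by auto
  show ?thesis
    by (rule oriented_hypersurface_cong[OF oriented[OF \<tau>]]) (simp_all add: F_eq[OF _ assms] U_eq[OF _ assms])
qed

lemma parallel_well_defined:
  assumes "\<delta> \<in> {\<tau>\<^sub>0 - pi / g<..<\<tau>\<^sub>0}"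
  shows "curvature_well_defined \<A> X \<Gamma> (F \<delta>) (U \<delta>)"
proof -
  have \<tau>: "\<tau>\<^sub>0 - \<delta> \<in> {0<..<pi / g}" using assms by auto
  show ?thesis
    by (rule curvature_well_defined_cong[OF well_defined[OF \<tau>]])
      (simp_all add: F_eq[OF _ assms] U_eq[OF _ assms])
qed

text \<open>The curvatures of \<open>f \<tau>\<^sub>0\<close> include \<open>cot \<tau>\<^sub>0\<close> (index \<open>i = 1\<close>) and, since \<open>cot\<close> has period \<open>\<pi>\<close>, also
  \<open>cot (\<tau>\<^sub>0 - \<pi>/g)\<close> (index \<open>i = g\<close>). The end values of \<open>\<delta>\<close> are the focal distances of these two.\<close>
lemma focal_at_endpoints:
  assumes p: "p \<in> topspace X" and \<delta>: "\<delta> = \<tau>\<^sub>0 \<or> \<delta> = \<tau>\<^sub>0 - pi / g"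
  shows "\<not> immersive_at \<A> (F \<delta>) p"
proof
  assume immersive: "immersive_at \<A> (F \<delta>) p"
  obtain k where k: "principal_curvatures \<A> (f \<tau>\<^sub>0) (N \<tau>\<^sub>0) p k"
    using common_curvatures[OF \<tau>\<^sub>0] p by blast
  have range_k: "range (($) k) = {cot (\<tau>\<^sub>0 + real (i - 1) * (pi / g)) | i. i \<in> {1..g}}"
    by (rule curvature_values[OF \<tau>\<^sub>0 p k])
  have g: "real (g - 1) * (pi / g) = pi - pi / g"
    using g_pos by (simp add: of_nat_diff field_simps)
  have "cot \<delta> \<in> {cot (\<tau>\<^sub>0 + real (i - 1) * (pi / g)) | i. i \<in> {1..g}}"
    using \<delta>
  proof
    assume "\<delta> = \<tau>\<^sub>0"
    then show ?thesis using g_pos by (intro CollectI exI[of _ 1]) auto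
  next
    assume "\<delta> = \<tau>\<^sub>0 - pi / g"
    then have "\<tau>\<^sub>0 + real (g - 1) * (pi / g) = \<delta> + pi" using g by simp
    then have "cot (\<tau>\<^sub>0 + real (g - 1) * (pi / g)) = cot \<delta>" by (simp add: cot_def)
    then show ?thesis using g_pos by (intro CollectI exI[of _ g]) auto
  qed
  then obtain i where i: "k $ i = cot \<delta>" using range_k by (metis rangeE)
  have "sin \<delta> \<noteq> 0"
    using \<delta>
  proof
    assume "\<delta> = \<tau>\<^sub>0"
    then show ?thesis using \<tau>\<^sub>0 pi_over_g_le sin_gt_zero[of \<delta>] by auto
  next
    assume "\<delta> = \<tau>\<^sub>0 - pi / g"
    then have "sin (- \<delta>) > 0" using \<tau>\<^sub>0 pi_over_g_le by (intro sin_gt_zero) auto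
    then show ?thesis by simp
  qed
  then have "cos \<delta> - k $ i * sin \<delta> = 0" by (simp add: i cot_def)
  then show False
    using immersive_at_parallel_imp_nonfocal[OF smooth k immersive] by blast
qed

text \<open>One curvature vector \<open>k\<close> of \<open>f \<tau>\<^sub>0\<close> serves all points \<open>p\<close>, hence so does the vector \<open>\<kappa> \<delta>\<close> of \<open>F \<delta>\<close>. Its
  denominators do not vanish because the members of the family are immersed, and it is smooth in \<open>\<delta>\<close>
  by the Riccati equation.\<close>
lemma speed_function:
  obtains w where "\<And>k. times_differentiable k {\<tau>\<^sub>0 - pi / g<..<\<tau>\<^sub>0} w"
    "\<And>p \<delta>. p \<in> topspace X \<Longrightarrow> \<delta> \<in> {\<tau>\<^sub>0 - pi / g<..<\<tau>\<^sub>0} \<Longrightarrow>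
       weingarten_curvature \<A> W (F \<delta>) (U \<delta>) p = w \<delta>"
proof -
  define I where "I = {\<tau>\<^sub>0 - pi / g<..<\<tau>\<^sub>0}"
  obtain k where k: "\<And>p. p \<in> topspace X \<Longrightarrow> principal_curvatures \<A> (f \<tau>\<^sub>0) (N \<tau>\<^sub>0) p k"
    using common_curvatures[OF \<tau>\<^sub>0] by blast
  obtain p\<^sub>0 where p\<^sub>0: "p\<^sub>0 \<in> topspace X" using topspace_nonempty by blast
  have immersive: "immersive_at \<A> (F \<delta>) p" if "\<delta> \<in> I" "p \<in> topspace X" for \<delta> p
    using parallel_oriented[of \<delta>] that unfolding oriented_hypersurface_def I_def by blast
  have nonfocal: "cos \<delta> - k $ i * sin \<delta> \<noteq> 0" if "\<delta> \<in> I" for \<delta> i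
    using immersive_at_parallel_imp_nonfocal[OF smooth k[OF p\<^sub>0] immersive[OF that p\<^sub>0]] .
  define \<kappa> where "\<kappa> \<delta> = (\<chi> i. parallel_curvature (k $ i) \<delta>)" for \<delta>
  have \<kappa>: "principal_curvatures \<A> (F \<delta>) (U \<delta>) p (\<kappa> \<delta>)" if "\<delta> \<in> I" "p \<in> topspace X" for \<delta> p
    unfolding \<kappa>_def using principal_curvatures_parallel[OF smooth k[OF that(2)] nonfocal[OF that(1)]] .
  have \<kappa>_\<Gamma>: "\<kappa> \<delta> \<in> \<Gamma>" if "\<delta> \<in> I" for \<delta>
    using parallel_well_defined[of \<delta>] \<kappa>[OF that p\<^sub>0] that p\<^sub>0
    unfolding curvature_well_defined_def I_def by blast
  have "times_differentiable n I (\<lambda>\<delta>. \<kappa> \<delta> $ i)" for n i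
  proof (rule times_differentiable_autonomous[where h = "\<lambda>x. 1 + x * x" and I = UNIV])
    show "((\<lambda>\<delta>. \<kappa> \<delta> $ i) has_real_derivative 1 + \<kappa> \<delta> $ i * \<kappa> \<delta> $ i) (at \<delta>)" if "\<delta> \<in> I" for \<delta>
      using parallel_curvature_has_derivative[OF nonfocal[OF that, of i]]
      by (simp add: \<kappa>_def power2_eq_square)
    show "times_differentiable n UNIV (\<lambda>x. 1 + x * x)" for n
      by (intro times_differentiable_add times_differentiable_mult times_differentiable_const times_differentiable_id)
  qed simp
  moreover have "Ck_on n \<Gamma> W" for n
    using weingarten unfolding weingarten_function_def smooth_on_def by blast
  ultimately have "times_differentiable n I (\<lambda>\<delta>. W (\<kappa> \<delta>))" for n
    using times_differentiable_curve[of I \<kappa> \<Gamma> n W] \<kappa>_\<Gamma> by blast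
  moreover have "weingarten_curvature \<A> W (F \<delta>) (U \<delta>) p = W (\<kappa> \<delta>)"
    if p: "p \<in> topspace X" and \<delta>: "\<delta> \<in> I" for p \<delta>
  proof -
    have smooth': "smooth_map \<A> (F \<delta>)" "smooth_map \<A> (U \<delta>)"
      using parallel_oriented[of \<delta>] \<delta> unfolding oriented_hypersurface_def I_def by blast+
    have "principal_curvatures \<A> (F \<delta>) (U \<delta>) p (SOME k. principal_curvatures \<A> (F \<delta>) (U \<delta>) p k)"
      using \<kappa>[OF \<delta> p] by (rule someI)
    then obtain \<pi> where "bij \<pi>"
      and \<pi>: "(SOME k. principal_curvatures \<A> (F \<delta>) (U \<delta>) p k) = (\<chi> i. \<kappa> \<delta> $ \<pi> i)"
      using principal_curvatures_permuted[OF smooth' immersive[OF \<delta> p] \<kappa>[OF \<delta> p]] by blast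
    then show ?thesis
      using weingarten \<kappa>_\<Gamma>[OF \<delta>] unfolding weingarten_curvature_def \<pi> weingarten_function_def
      by blast
  qed
  ultimately show ?thesis
    using that[of "\<lambda>\<delta>. W (\<kappa> \<delta>)"] unfolding I_def by blast
qed

text \<open>\<open>M\<close> is homeomorphic to a level set of \<open>P\<close> on the sphere, which is closed and bounded.\<close>
lemma compact_topspace: "compact_space X"
proof -
  obtain c where c: "f \<tau>\<^sub>0 ` topspace X = level P c"
    using image_level[OF \<tau>\<^sub>0] by blast
  have "continuous_on UNIV P"
    using polynomial(1) continuous_on_polymonial_function real_polynomial_function_eq by blast
  then have "closed (P -` {c})" by (simp add: closed_vimage)
  then have "compact (unit_sphere \<inter> P -` {c})"
    by (intro compact_Int_closed) auto
  moreover have "level P c = unit_sphere \<inter> P -` {c}" by (auto simp: level_def)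
  ultimately have "compact_space (top_of_set (f \<tau>\<^sub>0 ` topspace X))"
    unfolding c by (simp add: compact_space_subtopology)
  moreover have "X homeomorphic_space top_of_set (f \<tau>\<^sub>0 ` topspace X)"
    using embedding[OF \<tau>\<^sub>0] unfolding embedding_map_def by (rule homeomorphic_map_imp_homeomorphic_space)
  ultimately show ?thesis by (simp add: homeomorphic_compact_space)
qed

text \<open>The swept set is compact and contains the dense set of points with \<open>\<bar>P\<bar> < 1\<close>, all of which lie on
  members of the family.\<close>
lemma parallel_maps_sweep_sphere:
  assumes "y \<in> unit_sphere"
  obtains p \<delta> where "p \<in> topspace X" "\<delta> \<in> {\<tau>\<^sub>0 - pi / g..\<tau>\<^sub>0}" "y = F \<delta> p"
proof -
  define C where "C = (\<lambda>p. (f \<tau>\<^sub>0 p, N \<tau>\<^sub>0 p)) ` topspace X"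
  have "continuous_map X (prod_topology euclidean euclidean) (\<lambda>p. (f \<tau>\<^sub>0 p, N \<tau>\<^sub>0 p))"
    by (intro continuous_map_pairedI smooth_map_continuous smooth)
  moreover have "compactin X (topspace X)"
    using compact_topspace by (simp add: compact_space_def)
  ultimately have "compact C"
    unfolding C_def using image_compactin by fastforce
  define \<Psi> where "\<Psi> = (\<lambda>((x, v), \<delta>). cos \<delta> *\<^sub>R x + sin \<delta> *\<^sub>R v :: 'e)"
  define K where "K = \<Psi> ` (C \<times> {\<tau>\<^sub>0 - pi / g..\<tau>\<^sub>0})"
  have "compact K"
    unfolding K_def \<Psi>_def case_prod_unfold
    by (intro compact_continuous_image continuous_intros compact_Times \<open>compact C\<close> compact_Icc)
  then have "closed K" by (rule compact_imp_closed)
  have K: "z \<in> K \<longleftrightarrow> (\<exists>p\<in>topspace X. \<exists>\<delta>\<in>{\<tau>\<^sub>0 - pi / g..\<tau>\<^sub>0}. z = F \<delta> p)" for z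
    unfolding K_def C_def \<Psi>_def parallel_hypersurface_def by force
  have "{z \<in> unit_sphere. \<bar>P z\<bar> < 1} \<subseteq> K"
  proof clarify
    fix z :: 'e assume z: "z \<in> unit_sphere" "\<bar>P z\<bar> < 1"
    then obtain \<tau> where \<tau>: "\<tau> \<in> {0<..<pi / g}" "f \<tau> ` topspace X = level P (P z)"
      using level_attained[of "P z"] by (auto simp: abs_less_iff)
    moreover have "z \<in> level P (P z)" using z by (simp add: level_def)
    ultimately obtain p where p: "p \<in> topspace X" "z = f \<tau> p" by blast
    then have "z = F (\<tau>\<^sub>0 - \<tau>) p" using on_normal_geodesic(1) \<tau>(1) by blast
    then show "z \<in> K"
      unfolding K using p(1) \<tau>(1) by (intro bexI[of _ p] bexI[of _ "\<tau>\<^sub>0 - \<tau>"]) auto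
  qed
  then have closure: "closure {z \<in> unit_sphere. \<bar>P z\<bar> < 1} \<subseteq> K"
    using \<open>closed K\<close> by (rule closure_minimal)
  obtain \<tau> where "f \<tau> ` topspace X = level P 0" using level_attained[of 0] by auto
  then obtain w where "w \<in> level P 0" using topspace_nonempty by blast
  then have "y \<in> closure {z \<in> unit_sphere. \<bar>P z\<bar> < 1}"
    using assms
    by (intro nonextreme_points_dense[OF polynomial, of w]) (simp_all add: level_def)
  then show ?thesis using that closure K by blast
qed

text \<open>A point with \<open>P = \<plusminus>1\<close> is swept out by some \<open>F \<delta>\<close>; strictly between the end values \<open>\<bar>P\<bar> < 1\<close>, and at the
  two ends \<open>P\<close> has opposite signs, so \<open>\<delta>\<close> is the end value in question.\<close>
lemma focal_limit_maps_onto: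
  shows "F \<tau>\<^sub>0 ` topspace X = level P 1" and "F (\<tau>\<^sub>0 - pi / g) ` topspace X = level P (-1)"
proof -
  have extreme: "\<delta> = \<tau>\<^sub>0 \<and> P (F \<delta> p) = 1 \<or> \<delta> = \<tau>\<^sub>0 - pi / g \<and> P (F \<delta> p) = -1"
    if p: "p \<in> topspace X" and \<delta>: "\<delta> \<in> {\<tau>\<^sub>0 - pi / g..\<tau>\<^sub>0}" and P: "\<bar>P (F \<delta> p)\<bar> = 1" for \<delta> p
  proof (cases "\<delta> \<in> {\<tau>\<^sub>0 - pi / g<..<\<tau>\<^sub>0}")
    case True
    then have "\<tau>\<^sub>0 - \<delta> \<in> {0<..<pi / g}" by auto
    then obtain c where "c \<in> {-1<..<1}" "f (\<tau>\<^sub>0 - \<delta>) ` topspace X = level P c"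
      using image_level by blast
    then have "F \<delta> p \<in> level P c" "\<bar>c\<bar> < 1" using F_eq[OF p True] p by auto
    then have "\<bar>P (F \<delta> p)\<bar> < 1" by (simp add: level_def)
    with P show ?thesis by simp
  next
    case False
    then have "\<delta> = \<tau>\<^sub>0 \<or> \<delta> = \<tau>\<^sub>0 - pi / g" using \<delta> by auto
    then show ?thesis using on_normal_geodesic(3,4)[OF p] by (auto simp: level_def)
  qed
  have "y \<in> F \<tau>\<^sub>0 ` topspace X" if "y \<in> level P 1" for y
  proof -
    have y: "y \<in> unit_sphere" "P y = 1" using that by (simp_all add: level_def)
    from parallel_maps_sweep_sphere[OF y(1)]
    obtain p \<delta> where "p \<in> topspace X" "\<delta> \<in> {\<tau>\<^sub>0 - pi / g..\<tau>\<^sub>0}" "y = F \<delta> p" .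
    then show ?thesis using extreme[of p \<delta>] y(2) by auto
  qed
  then show "F \<tau>\<^sub>0 ` topspace X = level P 1" using on_normal_geodesic(3) by blast
  have "y \<in> F (\<tau>\<^sub>0 - pi / g) ` topspace X" if "y \<in> level P (-1)" for y
  proof -
    have y: "y \<in> unit_sphere" "P y = -1" using that by (simp_all add: level_def)
    from parallel_maps_sweep_sphere[OF y(1)]
    obtain p \<delta> where "p \<in> topspace X" "\<delta> \<in> {\<tau>\<^sub>0 - pi / g..\<tau>\<^sub>0}" "y = F \<delta> p" .
    then show ?thesis using extreme[of p \<delta>] y(2) by auto
  qed
  then show "F (\<tau>\<^sub>0 - pi / g) ` topspace X = level P (-1)" using on_normal_geodesic(4) by blast
qed

lemma parallel_family_F:
  "p \<in> topspace X \<Longrightarrow> parallel_family (f \<tau>\<^sub>0) (N \<tau>\<^sub>0) \<phi> t p = F (\<phi> t) p"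
  by (simp add: parallel_family_eq norm_eq_1)

lemma parallel_normal_U:
  "p \<in> topspace X \<Longrightarrow> parallel_normal (f \<tau>\<^sub>0) (N \<tau>\<^sub>0) \<phi> t p = U (\<phi> t) p"
  by (simp add: parallel_normal_eq norm_eq_1)

lemma parallel_motion_has_derivative:
  assumes "(\<phi> has_real_derivative d) (at t within S)"
  shows "((\<lambda>s. F (\<phi> s) p) has_vector_derivative d *\<^sub>R U (\<phi> t) p) (at t within S)"
proof -
  have "((\<lambda>s. cos (\<phi> s)) has_real_derivative - sin (\<phi> t) * d) (at t within S)"
    "((\<lambda>s. sin (\<phi> s)) has_real_derivative cos (\<phi> t) * d) (at t within S)"
    using assms by (auto intro!: derivative_eq_intros)
  then have "((\<lambda>s. F (\<phi> s) p) has_derivative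
      (\<lambda>h. (- sin (\<phi> t) * d * h) *\<^sub>R f \<tau>\<^sub>0 p + (cos (\<phi> t) * d * h) *\<^sub>R N \<tau>\<^sub>0 p)) (at t within S)"
    unfolding parallel_hypersurface_def
    by (intro has_derivative_add has_derivative_scaleR_left) (simp_all only: has_field_derivative_def)
  then show ?thesis
    by (simp add: has_vector_derivative_def parallel_unit_normal_def
        scaleR_add_right scaleR_diff_right mult_ac)
qed

text \<open>The flow equation at one point \<open>p\<close> reads \<open>\<psi>' \<cdot> U = w(\<psi>) \<cdot> U\<close> as soon as \<open>\<psi>\<close> lies in the interval where
  \<open>w\<close> gives the curvature. It cannot leave this interval: by the intermediate value theorem it would
  pass an end value, where the flow would not be immersed.\<close>
lemma parallel_solution_imp_solves_ivp:
  assumes speed: "\<And>p \<delta>. p \<in> topspace X \<Longrightarrow> \<delta> \<in> {\<tau>\<^sub>0 - pi / g<..<\<tau>\<^sub>0} \<Longrightarrow>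
       weingarten_curvature \<A> W (F \<delta>) (U \<delta>) p = w \<delta>"
    and sol: "parallel_solution \<A> X \<Gamma> W (f \<tau>\<^sub>0) (N \<tau>\<^sub>0) T \<psi>"
  shows "solves_ivp (\<tau>\<^sub>0 - pi / g) \<tau>\<^sub>0 w T \<psi>"
proof -
  let ?F = "parallel_family (f \<tau>\<^sub>0) (N \<tau>\<^sub>0) \<psi>" and ?N = "parallel_normal (f \<tau>\<^sub>0) (N \<tau>\<^sub>0) \<psi>"
  let ?I = "{\<tau>\<^sub>0 - pi / g<..<\<tau>\<^sub>0}"
  have \<psi>0: "\<psi> 0 = 0" and flow: "W_flow \<A> X \<Gamma> W (f \<tau>\<^sub>0) T ?F ?N"
    and "smooth_time T \<psi>"
    using sol unfolding parallel_solution_def by auto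
  then obtain D where D: "\<And>t. t \<in> time_interval T \<Longrightarrow>
      (\<psi> has_real_derivative D t) (at t within time_interval T)"
    unfolding smooth_time_def by metis
  obtain p where p: "p \<in> topspace X" using topspace_nonempty by blast
  have immersive: "immersive_at \<A> (F (\<psi> t)) p" if "t \<in> time_interval T" for t
  proof -
    have "immersive_at \<A> (?F t) p"
      using flow that p unfolding W_flow_def oriented_hypersurface_def by blast
    moreover have "immersive_at \<A> (?F t) p \<longleftrightarrow> immersive_at \<A> (F (\<psi> t)) p"
      by (rule immersive_at_cong) (rule parallel_family_F)
    ultimately show ?thesis by simp
  qed
  then have avoid: "\<psi> t \<noteq> \<tau>\<^sub>0" "\<psi> t \<noteq> \<tau>\<^sub>0 - pi / g" if "t \<in> time_interval T" for t
    using focal_at_endpoints[OF p, of "\<psi> t"] that by auto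
  have cont: "continuous_on (time_interval T) \<psi>"
    using D by (auto simp: continuous_on_eq_continuous_within intro: DERIV_continuous)
  have inside: "\<psi> t \<in> ?I" if t: "t \<in> time_interval T" for t
  proof -
    have t0: "0 \<le> t" using t by (simp add: time_interval_def)
    have sub: "{0..t} \<subseteq> time_interval T" using time_interval_downward[OF t] by auto
    then have cont': "continuous_on {0..t} \<psi>" using cont continuous_on_subset by blast
    have "\<psi> t < \<tau>\<^sub>0"
    proof (rule ccontr)
      assume "\<not> \<psi> t < \<tau>\<^sub>0"
      then have "\<exists>s\<ge>0. s \<le> t \<and> \<psi> s = \<tau>\<^sub>0"
        using \<psi>0 \<tau>\<^sub>0 t0 cont' by (intro IVT') auto
      then obtain s where "0 \<le> s" "s \<le> t" "\<psi> s = \<tau>\<^sub>0" by blast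
      then show False using avoid(1)[of s] sub by (simp add: subset_eq)
    qed
    moreover have "\<tau>\<^sub>0 - pi / g < \<psi> t"
    proof (rule ccontr)
      assume "\<not> \<tau>\<^sub>0 - pi / g < \<psi> t"
      then have "\<exists>s\<ge>0. s \<le> t \<and> \<psi> s = \<tau>\<^sub>0 - pi / g"
        using \<psi>0 \<tau>\<^sub>0 t0 cont' by (intro IVT2') auto
      then obtain s where "0 \<le> s" "s \<le> t" "\<psi> s = \<tau>\<^sub>0 - pi / g" by blast
      then show False using avoid(2)[of s] sub by (simp add: subset_eq)
    qed
    ultimately show ?thesis by simp
  qed
  have "D t = w (\<psi> t)" if t: "t \<in> time_interval T" for t
  proof -
    have "weingarten_curvature \<A> W (?F t) (?N t) p = weingarten_curvature \<A> W (F (\<psi> t)) (U (\<psi> t)) p"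
      by (rule weingarten_curvature_cong) (rule parallel_family_F parallel_normal_U, assumption)+
    then have W: "weingarten_curvature \<A> W (?F t) (?N t) p = w (\<psi> t)"
      using speed[OF p inside[OF t]] by simp
    have "((\<lambda>s. ?F s p) has_vector_derivative weingarten_curvature \<A> W (?F t) (?N t) p *\<^sub>R ?N t p)
        (at t within time_interval T)"
      using flow t p unfolding W_flow_def by blast
    then have 1: "((\<lambda>s. F (\<psi> s) p) has_vector_derivative w (\<psi> t) *\<^sub>R U (\<psi> t) p)
        (at t within time_interval T)"
      by (simp add: W parallel_family_F[OF p] parallel_normal_U[OF p])
    have "ereal t < T" "0 \<le> t" using t by (simp_all add: time_interval_def)
    then obtain t' where t': "t < t'" "ereal t' < T"
      using ereal_dense2[of "ereal t" T] by auto
    then have "t' \<in> time_interval T" using \<open>0 \<le> t\<close> by (simp add: time_interval_def)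
    then have "{t..t'} \<subseteq> time_interval T"
      using time_interval_downward[of t' T] \<open>0 \<le> t\<close> by auto
    moreover have "t islimpt {t..t'}" using t' by simp
    ultimately have "t islimpt time_interval T" using islimpt_subset by blast
    then have "at t within time_interval T \<noteq> bot" by (simp add: trivial_limit_within)
    from vector_derivative_unique_within[OF this 1 parallel_motion_has_derivative[OF D[OF t]]]
    have "w (\<psi> t) *\<^sub>R U (\<psi> t) p = D t *\<^sub>R U (\<psi> t) p" .
    moreover have "norm (U (\<psi> t) p) = 1"
      using parallel_oriented[OF inside[OF t]] p unfolding oriented_hypersurface_def by blast
    ultimately show ?thesis by auto
  qed
  then show ?thesis
    unfolding solves_ivp_def using \<psi>0 inside D by auto
qed

lemma solves_ivp_imp_parallel_solution:
  assumes speed: "\<And>p \<delta>. p \<in> topspace X \<Longrightarrow> \<delta> \<in> {\<tau>\<^sub>0 - pi / g<..<\<tau>\<^sub>0} \<Longrightarrow>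
       weingarten_curvature \<A> W (F \<delta>) (U \<delta>) p = w \<delta>"
    and sol: "solves_ivp (\<tau>\<^sub>0 - pi / g) \<tau>\<^sub>0 w T \<phi>" and "smooth_time T \<phi>" and "0 < T"
  shows "parallel_solution \<A> X \<Gamma> W (f \<tau>\<^sub>0) (N \<tau>\<^sub>0) T \<phi>"
proof -
  let ?F = "parallel_family (f \<tau>\<^sub>0) (N \<tau>\<^sub>0) \<phi>" and ?N = "parallel_normal (f \<tau>\<^sub>0) (N \<tau>\<^sub>0) \<phi>"
  have \<phi>0: "\<phi> 0 = 0" using sol by (simp add: solves_ivp_def)
  have "oriented_hypersurface \<A> X (?F t) (?N t) \<and> curvature_well_defined \<A> X \<Gamma> (?F t) (?N t) \<and>
      (\<forall>p\<in>topspace X. ((\<lambda>s. ?F s p) has_vector_derivative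
         weingarten_curvature \<A> W (?F t) (?N t) p *\<^sub>R ?N t p) (at t within time_interval T))"
    if t: "t \<in> time_interval T" for t
  proof (intro conjI ballI)
    have inside: "\<phi> t \<in> {\<tau>\<^sub>0 - pi / g<..<\<tau>\<^sub>0}"
      and \<phi>': "(\<phi> has_real_derivative w (\<phi> t)) (at t within time_interval T)"
      using sol t unfolding solves_ivp_def by blast+
    show "oriented_hypersurface \<A> X (?F t) (?N t)"
      by (rule oriented_hypersurface_cong[OF parallel_oriented[OF inside]])
        (simp_all add: parallel_family_F parallel_normal_U)
    show "curvature_well_defined \<A> X \<Gamma> (?F t) (?N t)"
      by (rule curvature_well_defined_cong[OF parallel_well_defined[OF inside]])
        (simp_all add: parallel_family_F parallel_normal_U)
    fix p assume p: "p \<in> topspace X"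
    have "weingarten_curvature \<A> W (?F t) (?N t) p = weingarten_curvature \<A> W (F (\<phi> t)) (U (\<phi> t)) p"
      by (rule weingarten_curvature_cong) (rule parallel_family_F parallel_normal_U, assumption)+
    also have "\<dots> = w (\<phi> t)" by (rule speed[OF p inside])
    finally show "((\<lambda>s. ?F s p) has_vector_derivative
        weingarten_curvature \<A> W (?F t) (?N t) p *\<^sub>R ?N t p) (at t within time_interval T)"
      using parallel_motion_has_derivative[OF \<phi>', of p]
      by (simp add: parallel_family_F[OF p] parallel_normal_U[OF p])
  qed
  moreover have "?F 0 p = f \<tau>\<^sub>0 p" if "p \<in> topspace X" for p
    using parallel_family_F[OF that, of \<phi> 0] by (simp add: \<phi>0 parallel_hypersurface_def)
  ultimately show ?thesis
    unfolding parallel_solution_def W_flow_def using assms(3,4) \<phi>0 by blast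
qed

text \<open>The bound on the distance from the limit map depends only on \<open>\<phi>\<close>, which makes the convergence
  uniform in \<open>p\<close>.\<close>
lemma F_collapses:
  assumes lim: "(\<phi> \<longlongrightarrow> L) (at_left T)" and onto: "F L ` topspace X = A"
  shows "collapses_into X (parallel_family (f \<tau>\<^sub>0) (N \<tau>\<^sub>0) \<phi>) T A"
proof -
  have "((\<lambda>t. \<bar>cos (\<phi> t) - cos L\<bar> + \<bar>sin (\<phi> t) - sin L\<bar>) \<longlongrightarrow>
      \<bar>cos L - cos L\<bar> + \<bar>sin L - sin L\<bar>) (at_left T)"
    by (intro tendsto_intros lim)
  then have small: "((\<lambda>t. \<bar>cos (\<phi> t) - cos L\<bar> + \<bar>sin (\<phi> t) - sin L\<bar>) \<longlongrightarrow> 0) (at_left T)"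
    by simp
  have close: "dist (parallel_family (f \<tau>\<^sub>0) (N \<tau>\<^sub>0) \<phi> t p) (F L p)
      \<le> \<bar>cos (\<phi> t) - cos L\<bar> + \<bar>sin (\<phi> t) - sin L\<bar>" if p: "p \<in> topspace X" for t p
  proof -
    have "F (\<phi> t) p - F L p = (cos (\<phi> t) - cos L) *\<^sub>R f \<tau>\<^sub>0 p + (sin (\<phi> t) - sin L) *\<^sub>R N \<tau>\<^sub>0 p"
      by (simp add: parallel_hypersurface_def algebra_simps)
    then have "norm (F (\<phi> t) p - F L p)
        \<le> norm ((cos (\<phi> t) - cos L) *\<^sub>R f \<tau>\<^sub>0 p) + norm ((sin (\<phi> t) - sin L) *\<^sub>R N \<tau>\<^sub>0 p)"
      by (simp only: norm_triangle_ineq)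
    then show ?thesis
      by (simp add: parallel_family_F[OF p] dist_norm norm_eq_1[OF p])
  qed
  have "uniform_limit (topspace X) (parallel_family (f \<tau>\<^sub>0) (N \<tau>\<^sub>0) \<phi>) (F L) (at_left T)"
  proof (rule uniform_limitI)
    fix e :: real assume "0 < e"
    then have "eventually (\<lambda>t. \<bar>cos (\<phi> t) - cos L\<bar> + \<bar>sin (\<phi> t) - sin L\<bar> < e) (at_left T)"
      using order_tendstoD(2)[OF small] by blast
    then show "eventually (\<lambda>t. \<forall>p\<in>topspace X.
        dist (parallel_family (f \<tau>\<^sub>0) (N \<tau>\<^sub>0) \<phi> t p) (F L p) < e) (at_left T)"
      by (rule eventually_mono) (use close in \<open>auto intro: le_less_trans\<close>)
  qed
  then show ?thesis unfolding collapses_into_def using onto by blast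
qed

text \<open>Every parallel solution solves the scalar equation, hence is a restriction of \<open>\<phi>\<close> to a shorter
  or equal interval; so \<open>\<phi>\<close> on \<open>[0,T)\<close> is the only maximal one.\<close>
lemma parallel_flow_from_ode:
  assumes speed: "\<And>p \<delta>. p \<in> topspace X \<Longrightarrow> \<delta> \<in> {\<tau>\<^sub>0 - pi / g<..<\<tau>\<^sub>0} \<Longrightarrow>
       weingarten_curvature \<A> W (F \<delta>) (U \<delta>) p = w \<delta>"
    and w: "\<And>k. times_differentiable k {\<tau>\<^sub>0 - pi / g<..<\<tau>\<^sub>0} w"
    and T: "0 < (T :: real)" and J: "open J" "{0..<T} \<subseteq> J"
    and \<phi>: "\<forall>t\<in>J. \<phi> t \<in> {\<tau>\<^sub>0 - pi / g<..<\<tau>\<^sub>0} \<and> (\<phi> has_real_derivative w (\<phi> t)) (at t)"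
    and \<phi>0: "\<phi> 0 = 0" and lim: "(\<phi> \<longlongrightarrow> L) (at_left T)"
    and unique: "\<forall>T' \<psi>. solves_ivp (\<tau>\<^sub>0 - pi / g) \<tau>\<^sub>0 w T' \<psi> \<longrightarrow>
      (\<forall>t\<in>time_interval T'. t < T \<and> \<psi> t = \<phi> t)"
    and onto: "F L ` topspace X = A"
  shows "maximal_parallel_solution \<A> X \<Gamma> W (f \<tau>\<^sub>0) (N \<tau>\<^sub>0) T \<phi> \<and>
        (\<forall>(T'::ereal) \<psi>. maximal_parallel_solution \<A> X \<Gamma> W (f \<tau>\<^sub>0) (N \<tau>\<^sub>0) T' \<psi> \<longrightarrow>
           T' = T \<and> (\<forall>t\<in>{0..<T}. \<psi> t = \<phi> t)) \<and>
        (\<forall>t\<in>{0..<T}. \<tau>\<^sub>0 - \<phi> t \<in> {0<..<pi / g} \<and>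
           (\<forall>p\<in>topspace X. parallel_family (f \<tau>\<^sub>0) (N \<tau>\<^sub>0) \<phi> t p = f (\<tau>\<^sub>0 - \<phi> t) p)) \<and>
        (\<phi> \<longlongrightarrow> L) (at_left T) \<and>
        collapses_into X (parallel_family (f \<tau>\<^sub>0) (N \<tau>\<^sub>0) \<phi>) T A"
proof (intro conjI)
  let ?sol = "parallel_solution \<A> X \<Gamma> W (f \<tau>\<^sub>0) (N \<tau>\<^sub>0)"
  have at_within: "(\<psi> has_real_derivative d) (at t within time_interval T)"
    if "(\<psi> has_real_derivative d) (at t)" for \<psi> d t
    using that has_field_derivative_at_within by blast
  have ivp: "solves_ivp (\<tau>\<^sub>0 - pi / g) \<tau>\<^sub>0 w T \<phi>"
    unfolding solves_ivp_def using \<phi> \<phi>0 J(2) at_within by (auto simp: time_interval_real)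
  have "times_differentiable k J \<phi>" for k
    using \<phi> w by (intro times_differentiable_autonomous[of J \<phi> w "{\<tau>\<^sub>0 - pi / g<..<\<tau>\<^sub>0}"]) blast+
  then obtain D :: "nat \<Rightarrow> real \<Rightarrow> real" where "D 0 = \<phi>"
    and "\<And>k t. t \<in> J \<Longrightarrow> (D k has_real_derivative D (Suc k) t) (at t)"
    using times_differentiable_derivatives[OF J(1)] by blast
  then have "smooth_time T \<phi>"
    unfolding smooth_time_def using J(2) at_within
    by (intro exI[of _ D]) (auto simp: time_interval_real)
  then have sol: "?sol T \<phi>"
    using solves_ivp_imp_parallel_solution[OF speed ivp] T by simp
  have before: "T' \<le> T" and agree: "\<forall>t\<in>time_interval T'. \<psi> t = \<phi> t" if "?sol T' \<psi>" for T' \<psi>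
  proof -
    have ag: "\<forall>t\<in>time_interval T'. t < T \<and> \<psi> t = \<phi> t"
      using unique parallel_solution_imp_solves_ivp[OF speed that] by blast
    then show "\<forall>t\<in>time_interval T'. \<psi> t = \<phi> t" by blast
    have "T \<notin> time_interval T'" using ag by blast
    then show "T' \<le> T" using T by (simp add: time_interval_def not_less)
  qed
  show max: "maximal_parallel_solution \<A> X \<Gamma> W (f \<tau>\<^sub>0) (N \<tau>\<^sub>0) T \<phi>"
    unfolding maximal_parallel_solution_def using sol before by (auto simp: not_less[symmetric])
  show "\<forall>(T'::ereal) \<psi>. maximal_parallel_solution \<A> X \<Gamma> W (f \<tau>\<^sub>0) (N \<tau>\<^sub>0) T' \<psi> \<longrightarrow>
           T' = T \<and> (\<forall>t\<in>{0..<T}. \<psi> t = \<phi> t)"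
  proof (intro allI impI)
    fix T' \<psi> assume max': "maximal_parallel_solution \<A> X \<Gamma> W (f \<tau>\<^sub>0) (N \<tau>\<^sub>0) T' \<psi>"
    then have sol': "?sol T' \<psi>" by (simp add: maximal_parallel_solution_def)
    have "\<not> T' < T"
      using max' sol agree[OF sol'] unfolding maximal_parallel_solution_def by metis
    then have "T' = T" using before[OF sol'] by simp
    then show "T' = T \<and> (\<forall>t\<in>{0..<T}. \<psi> t = \<phi> t)"
      using agree[OF sol'] by (simp add: time_interval_real)
  qed
  show "\<forall>t\<in>{0..<T}. \<tau>\<^sub>0 - \<phi> t \<in> {0<..<pi / g} \<and>
      (\<forall>p\<in>topspace X. parallel_family (f \<tau>\<^sub>0) (N \<tau>\<^sub>0) \<phi> t p = f (\<tau>\<^sub>0 - \<phi> t) p)"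
  proof (intro ballI conjI)
    fix t assume "t \<in> {0..<T}"
    then have inside: "\<phi> t \<in> {\<tau>\<^sub>0 - pi / g<..<\<tau>\<^sub>0}" using \<phi> J(2) by blast
    then show "\<tau>\<^sub>0 - \<phi> t \<in> {0<..<pi / g}" by auto
    fix p assume "p \<in> topspace X"
    then show "parallel_family (f \<tau>\<^sub>0) (N \<tau>\<^sub>0) \<phi> t p = f (\<tau>\<^sub>0 - \<phi> t) p"
      by (simp only: parallel_family_F F_eq[OF _ inside])
  qed
  show "(\<phi> \<longlongrightarrow> L) (at_left T)" by (rule lim)
  show "collapses_into X (parallel_family (f \<tau>\<^sub>0) (N \<tau>\<^sub>0) \<phi>) T A"
    using lim onto by (rule F_collapses)
qed

end


section \<open>The collapse of the parallel flow\<close>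

theorem theorem2:
  fixes X :: "'a topology"
    and \<A> :: "('a, 'n::finite) chart set"
    and f N :: "real \<Rightarrow> 'a \<Rightarrow> 'e::euclidean_space"
    and P :: "'e \<Rightarrow> real" and g :: nat
    and \<Gamma> :: "(real ^ 'n) set" and W :: "real ^ 'n \<Rightarrow> real"
    and \<tau>\<^sub>0 :: real
  assumes "smooth_manifold X \<A>"
    and "isoparametric_family \<A> X g P f N"
    and "weingarten_function \<Gamma> W"
    and "\<forall>\<tau>\<in>{0<..<pi / g}. curvature_well_defined \<A> X \<Gamma> (f \<tau>) (N \<tau>)"
    and "\<tau>\<^sub>0 \<in> {0<..<pi / g}"
  shows
    "((\<forall>p\<in>topspace X. weingarten_curvature \<A> W (f \<tau>\<^sub>0) (N \<tau>\<^sub>0) p > 0) \<and>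
      (\<forall>p\<in>topspace X. mono_on {0..<\<tau>\<^sub>0}
         (\<lambda>\<tau>. weingarten_curvature \<A> W (f (\<tau>\<^sub>0 - \<tau>)) (N (\<tau>\<^sub>0 - \<tau>)) p))
      \<longrightarrow>
      (\<exists>(T::real) \<phi>. maximal_parallel_solution \<A> X \<Gamma> W (f \<tau>\<^sub>0) (N \<tau>\<^sub>0) T \<phi> \<and>
        (\<forall>(T'::ereal) \<psi>. maximal_parallel_solution \<A> X \<Gamma> W (f \<tau>\<^sub>0) (N \<tau>\<^sub>0) T' \<psi> \<longrightarrow>
           T' = T \<and> (\<forall>t\<in>{0..<T}. \<psi> t = \<phi> t)) \<and>
        (\<forall>t\<in>{0..<T}. \<tau>\<^sub>0 - \<phi> t \<in> {0<..<pi / g} \<and>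
           (\<forall>p\<in>topspace X. parallel_family (f \<tau>\<^sub>0) (N \<tau>\<^sub>0) \<phi> t p = f (\<tau>\<^sub>0 - \<phi> t) p)) \<and>
        (\<phi> \<longlongrightarrow> \<tau>\<^sub>0) (at_left T) \<and>
        collapses_into X (parallel_family (f \<tau>\<^sub>0) (N \<tau>\<^sub>0) \<phi>) T (level P 1)))
     \<and>
     ((\<forall>p\<in>topspace X. weingarten_curvature \<A> W (f \<tau>\<^sub>0) (N \<tau>\<^sub>0) p < 0) \<and>
      (\<forall>p\<in>topspace X. antimono_on {0..<pi / g - \<tau>\<^sub>0}
         (\<lambda>\<tau>. weingarten_curvature \<A> W (f (\<tau>\<^sub>0 + \<tau>)) (N (\<tau>\<^sub>0 + \<tau>)) p))
      \<longrightarrow>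
      (\<exists>(T::real) \<phi>. maximal_parallel_solution \<A> X \<Gamma> W (f \<tau>\<^sub>0) (N \<tau>\<^sub>0) T \<phi> \<and>
        (\<forall>(T'::ereal) \<psi>. maximal_parallel_solution \<A> X \<Gamma> W (f \<tau>\<^sub>0) (N \<tau>\<^sub>0) T' \<psi> \<longrightarrow>
           T' = T \<and> (\<forall>t\<in>{0..<T}. \<psi> t = \<phi> t)) \<and>
        (\<forall>t\<in>{0..<T}. \<tau>\<^sub>0 - \<phi> t \<in> {0<..<pi / g} \<and>
           (\<forall>p\<in>topspace X. parallel_family (f \<tau>\<^sub>0) (N \<tau>\<^sub>0) \<phi> t p = f (\<tau>\<^sub>0 - \<phi> t) p)) \<and>
        (\<phi> \<longlongrightarrow> \<tau>\<^sub>0 - pi / g) (at_left T) \<and>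
        collapses_into X (parallel_family (f \<tau>\<^sub>0) (N \<tau>\<^sub>0) \<phi>) T (level P (- 1))))"
proof -
  interpret isoparametric_weingarten_family X \<A> f N P g \<Gamma> W \<tau>\<^sub>0
    using assms by unfold_locales auto
  define a b where "a = \<tau>\<^sub>0 - pi / g" and "b = \<tau>\<^sub>0"
  have ab: "a < 0" "0 < b" using \<tau>\<^sub>0 by (auto simp: a_def b_def)
  obtain w where w: "\<And>k. times_differentiable k {\<tau>\<^sub>0 - pi / g<..<\<tau>\<^sub>0} w"
    and speed: "\<And>p \<delta>. p \<in> topspace X \<Longrightarrow> \<delta> \<in> {\<tau>\<^sub>0 - pi / g<..<\<tau>\<^sub>0} \<Longrightarrow>
       weingarten_curvature \<A> W (F \<delta>) (U \<delta>) p = w \<delta>"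
    using speed_function by blast
  have curvature: "weingarten_curvature \<A> W (f (\<tau>\<^sub>0 - \<delta>)) (N (\<tau>\<^sub>0 - \<delta>)) p = w \<delta>"
    if "p \<in> topspace X" "\<delta> \<in> {a<..<b}" for p \<delta>
  proof -
    have \<delta>: "\<delta> \<in> {\<tau>\<^sub>0 - pi / g<..<\<tau>\<^sub>0}" using that(2) by (simp add: a_def b_def)
    have "weingarten_curvature \<A> W (F \<delta>) (U \<delta>) p
        = weingarten_curvature \<A> W (f (\<tau>\<^sub>0 - \<delta>)) (N (\<tau>\<^sub>0 - \<delta>)) p"
      by (rule weingarten_curvature_cong) (rule F_eq[OF _ \<delta>] U_eq[OF _ \<delta>], assumption)+
    then show ?thesis using speed[OF that(1) \<delta>] by simp
  qed
  obtain p where p: "p \<in> topspace X" using topspace_nonempty by blast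
  have "times_differentiable (Suc 0) {a<..<b} w" using w unfolding a_def b_def by blast
  then have cont: "continuous_on {a<..<b} w"
    by (auto simp: continuous_on_eq_continuous_at intro: DERIV_isCont)
  note flow = parallel_flow_from_ode[OF speed w]
  show ?thesis
  proof (intro conjI impI; elim conjE)
    assume pos: "\<forall>p\<in>topspace X. weingarten_curvature \<A> W (f \<tau>\<^sub>0) (N \<tau>\<^sub>0) p > 0"
      and mono: "\<forall>p\<in>topspace X. mono_on {0..<\<tau>\<^sub>0}
         (\<lambda>\<tau>. weingarten_curvature \<A> W (f (\<tau>\<^sub>0 - \<tau>)) (N (\<tau>\<^sub>0 - \<tau>)) p)"
    have "0 < w 0" using bspec[OF pos p] curvature[OF p, of 0] ab by simp
    moreover have "w 0 \<le> w s" if "s \<in> {0..<b}" for s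
      using mono_onD[OF bspec[OF mono p], of 0 s] curvature[OF p, of 0] curvature[OF p, of s] that ab
      by (simp add: b_def)
    ultimately obtain T J \<phi> where ode: "0 < T" "open J" "{0..<T} \<subseteq> J"
      "\<forall>t\<in>J. \<phi> t \<in> {a<..<b} \<and> (\<phi> has_real_derivative w (\<phi> t)) (at t)"
      "\<phi> 0 = 0" "(\<phi> \<longlongrightarrow> b) (at_left T)"
      "\<forall>T' \<psi>. solves_ivp a b w T' \<psi> \<longrightarrow> (\<forall>t\<in>time_interval T'. t < T \<and> \<psi> t = \<phi> t)"
      using autonomous_ode_reaches_right_endpoint[OF ab cont] by blast
    show "\<exists>(T::real) \<phi>. maximal_parallel_solution \<A> X \<Gamma> W (f \<tau>\<^sub>0) (N \<tau>\<^sub>0) T \<phi> \<and>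
        (\<forall>(T'::ereal) \<psi>. maximal_parallel_solution \<A> X \<Gamma> W (f \<tau>\<^sub>0) (N \<tau>\<^sub>0) T' \<psi> \<longrightarrow>
           T' = T \<and> (\<forall>t\<in>{0..<T}. \<psi> t = \<phi> t)) \<and>
        (\<forall>t\<in>{0..<T}. \<tau>\<^sub>0 - \<phi> t \<in> {0<..<pi / g} \<and>
           (\<forall>p\<in>topspace X. parallel_family (f \<tau>\<^sub>0) (N \<tau>\<^sub>0) \<phi> t p = f (\<tau>\<^sub>0 - \<phi> t) p)) \<and>
        (\<phi> \<longlongrightarrow> \<tau>\<^sub>0) (at_left T) \<and>
        collapses_into X (parallel_family (f \<tau>\<^sub>0) (N \<tau>\<^sub>0) \<phi>) T (level P 1)"
      using ode focal_limit_maps_onto(1) unfolding a_def b_def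
      by (intro exI[of _ T] exI[of _ \<phi>] flow)
  next
    assume neg: "\<forall>p\<in>topspace X. weingarten_curvature \<A> W (f \<tau>\<^sub>0) (N \<tau>\<^sub>0) p < 0"
      and anti: "\<forall>p\<in>topspace X. antimono_on {0..<pi / g - \<tau>\<^sub>0}
         (\<lambda>\<tau>. weingarten_curvature \<A> W (f (\<tau>\<^sub>0 + \<tau>)) (N (\<tau>\<^sub>0 + \<tau>)) p)"
    have "w 0 < 0" using bspec[OF neg p] curvature[OF p, of 0] ab by simp
    moreover have "w s \<le> w 0" if "s \<in> {a<..0}" for s
      using monotone_onD[OF bspec[OF anti p], of 0 "- s"] curvature[OF p, of 0] curvature[OF p, of s] that ab
      by (simp add: a_def)
    ultimately obtain T J \<phi> where ode: "0 < T" "open J" "{0..<T} \<subseteq> J"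
      "\<forall>t\<in>J. \<phi> t \<in> {a<..<b} \<and> (\<phi> has_real_derivative w (\<phi> t)) (at t)"
      "\<phi> 0 = 0" "(\<phi> \<longlongrightarrow> a) (at_left T)"
      "\<forall>T' \<psi>. solves_ivp a b w T' \<psi> \<longrightarrow> (\<forall>t\<in>time_interval T'. t < T \<and> \<psi> t = \<phi> t)"
      using autonomous_ode_reaches_left_endpoint[OF ab cont] by blast
    show "\<exists>(T::real) \<phi>. maximal_parallel_solution \<A> X \<Gamma> W (f \<tau>\<^sub>0) (N \<tau>\<^sub>0) T \<phi> \<and>
        (\<forall>(T'::ereal) \<psi>. maximal_parallel_solution \<A> X \<Gamma> W (f \<tau>\<^sub>0) (N \<tau>\<^sub>0) T' \<psi> \<longrightarrow>
           T' = T \<and> (\<forall>t\<in>{0..<T}. \<psi> t = \<phi> t)) \<and>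
        (\<forall>t\<in>{0..<T}. \<tau>\<^sub>0 - \<phi> t \<in> {0<..<pi / g} \<and>
           (\<forall>p\<in>topspace X. parallel_family (f \<tau>\<^sub>0) (N \<tau>\<^sub>0) \<phi> t p = f (\<tau>\<^sub>0 - \<phi> t) p)) \<and>
        (\<phi> \<longlongrightarrow> \<tau>\<^sub>0 - pi / g) (at_left T) \<and>
        collapses_into X (parallel_family (f \<tau>\<^sub>0) (N \<tau>\<^sub>0) \<phi>) T (level P (- 1))"
      using ode focal_limit_maps_onto(2) unfolding a_def b_def
      by (intro exI[of _ T] exI[of _ \<phi>] flow)
  qed
qed

end
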